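(* Let $\Gamma$ be a graph, $\mathcal E$ a nondisconnecting subset of $E(\Gamma)$ and $\phi$ an acyclic flow on $\Gamma^{\mathcal E}$ such that $\operatorname{div}(\phi)$ has degree $-1$ on every exceptional vertex. Let $e_0\in E(\Gamma)$, and let $K=K_{\Gamma,\mathcal E,\phi}$, with set of extremal rays $K(1)$. With the notation of the context, if $e_0\in\mathcal E$, then the following equality of ideals of $A_\tau$ holds: $$\Bigl(\bigcap_{r\in K(1),\ u'_{e_0}(r)=0}I_{e_0,r}^{(\phi(e_0^t))}\Bigr)\cap\Bigl(\bigcap_{r\in K(1),\ u''_{e_0}(r)=0}I_{e_0,r}^{(\phi(e_0^s))}\Bigr)=\langle y_{e_0}\rangle^{\phi(e_0^s)}\,\bigl\langle y_{e_0},\chi^{u''_{e_0}}\bigr\rangle.$$ Otherwise, if $e_0\notin\mathcal E$, then $$\bigcap_{r\in K(1)}I_{e_0,r}^{(\phi(e_0))}=\langle y_{e_0}\rangle^{\phi(e_0)}.$$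
   Context: Graphs are finite; loops and multiple edges are allowed. For $\mathcal E\subset E(\Gamma)$, $\Gamma^{\mathcal E}$ is obtained by inserting exactly one new (exceptional) vertex $v_e$ in the interior of each $e\in\mathcal E$; $\mathcal E$ is nondisconnecting if removing the edges of $\mathcal E$ (keeping all vertices) leaves a connected graph. A flow on a graph is an orientation (source $s(e)$, target $t(e)$) with a function $\phi$ from edges to $\mathbb Z_{\ge0}$; it is acyclic if contracting all edges with $\phi(e)=0$ yields a digraph with no directed cycle (a loop is a directed cycle). $\operatorname{div}(\phi)(v)=\sum_{t(e)=v}\phi(e)-\sum_{s(e)=v}\phi(e)$. For a cycle $\gamma$ with a chosen direction of travel, $\gamma(e)=1,-1,0$ according to whether $e$ is traversed along its orientation, against it, or is not in $\gamma$. Cycles of $\Gamma$ and of $\Gamma^{\mathcal E}$ are identified. $C_{\Gamma,\mathcal E,\phi}=\{x\in\mathbb R_{\ge0}^{E(\Gamma^{\mathcal E})}:\sum_e\gamma(e)\phi(e)x_e=0\text{ for all cycles }\gamma\}$, and $K_{\Gamma,\mathcal E,\phi}\subset\mathbb R_{\ge0}^{E(\Gamma)}$ is its image under $x\mapsto(\sum_{e'\text{ over }e}x_{e'})_{e\in E(\Gamma)}$. An extremal ray $r$ is identified with its primitive generator. For $e\in\mathcal E$, since $\operatorname{div}(\phi)(v_e)=-1$ (reversing an edge of zero flow if necessary) the two edges over $e$ are named $e^s,e^t$ so that $v_e=t(e^s)=s(e^t)$; then $\phi(e^t)=\phi(e^s)+1$. If $e_0\in\mathcal E$: fix a spanning tree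 $T$ of $\Gamma$ disjoint from $\mathcal E$, and let $\gamma$ be the unique cycle containing $e_0$ with all other edges in $T$, directed so that $\gamma(e_0^s)=\gamma(e_0^t)=1$. Define linear functionals $u'_{e_0},u''_{e_0}$ on $\mathbb R^{E(\Gamma)}$ by: $u'_{e_0}(e)=u''_{e_0}(e)=0$ for $e\notin T\cup\{e_0\}$; $u'_{e_0}(e)=-\gamma(e)\phi(e)$ and $u''_{e_0}(e)=\gamma(e)\phi(e)$ for $e\in T$; $u'_{e_0}(e_0)=-\phi(e_0^s)$ and $u''_{e_0}(e_0)=\phi(e_0^t)$. (These lie in $K^\vee$.) Let $k$ be the (algebraically closed) base field, $M=\operatorname{Hom}(\mathbb Z^{E(\Gamma)},\mathbb Z)$, $S_K=K^\vee\cap M$, $A_K=k[S_K]=\bigoplus_{u\in S_K}k\chi^u$, and let $e_0^\vee\in S_K$ be the coordinate functional of $e_0$. Put $$A_\tau=A_K[x_{e_0},y_{e_0}]/\langle x_{e_0}y_{e_0}-\chi^{e_0^\vee}\rangle;$$ this is the toric algebra of the cone $\tau=\{(v,a,b)\in K\times\mathbb R^2_{\ge0}:e_0^\vee(v)=a+b\}$, with $x_{e_0},y_{e_0}$ the characters $a,b$. For $r\in K(1)$ let $\tau'$ be the face of $\tau$ which is the preimage of the ray $r$ under $\tau\to K$, and $\lambda\colon A_\tau\to A_{\tau'}$ the corresponding localization (explicitly, localization at the multiplicative set $\{\chi^u:u\in S_K,\ u(r)=0\}$). For $n\ge0$ define the ideals $I_{e_0,r}:=\lambda^{-1}(\langle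 y_{e_0}\rangle)$ and $I^{(n)}_{e_0,r}:=\lambda^{-1}(\langle y_{e_0}^n\rangle)$ of $A_\tau$. *)

theory Defs
  imports
    "Graph_Theory.Digraph_Component"
    "HOL-Algebra.QuotRing"
    "HOL-Algebra.Ideal_Product"
    "HOL-Library.Poly_Mapping"
    "HOL-Library.Function_Algebras"
    "HOL-Library.Product_Plus"
    "HOL-Computational_Algebra.Polynomial"
begin

section \<open>Graphs, subdivisions and flows\<close>

text \<open>
  A finite graph (loops and multiple edges allowed) is represented by a \<^locale>\<open>fin_digraph\<close>
  \<open>\<Gamma>\<close> whose arc directions carry no meaning: they only name the two ends of each edge.
  An orientation of \<open>\<Gamma>\<close> is a digraph \<open>D\<close> on the same vertices and edges in which each edge has
  the same two ends, possibly swapped.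
\<close>

definition orientation :: "('v, 'e) pre_digraph \<Rightarrow> ('v, 'e) pre_digraph \<Rightarrow> bool" where
  "orientation G D \<longleftrightarrow> verts D = verts G \<and> arcs D = arcs G \<and>
     (\<forall>e\<in>arcs G. {tail D e, head D e} = {tail G e, head G e})"

text \<open>
  \<open>(e, True)\<close> is \<open>e\<close> traversed along its orientation, \<open>(e, False)\<close> is \<open>e\<close> traversed against it.
\<close>

definition traversals :: "('v, 'e) pre_digraph \<Rightarrow> ('v, 'e \<times> bool) pre_digraph" where
  "traversals D = \<lparr>verts = verts D, arcs = arcs D \<times> UNIV,
     tail = (\<lambda>(e, b). if b then tail D e else head D e),
     head = (\<lambda>(e, b). if b then head D e else tail D e)\<rparr>"

text \<open>
  The cycles of the underlying undirected graph, each with a direction of travel. Distinctness of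
  the edges excludes going back and forth along a single edge; loops and pairs of parallel edges
  are cycles.
\<close>

definition undirected_cycle :: "('v, 'e) pre_digraph \<Rightarrow> ('e \<times> bool) list \<Rightarrow> bool" where
  "undirected_cycle D \<gamma> \<longleftrightarrow> pre_digraph.cycle (traversals D) \<gamma> \<and> distinct (map fst \<gamma>)"

definition cycle_sign :: "('e \<times> bool) list \<Rightarrow> 'e \<Rightarrow> int" where
  "cycle_sign \<gamma> e =
     (if (e, True) \<in> set \<gamma> then 1 else if (e, False) \<in> set \<gamma> then -1 else 0)"

definition nondisconnecting :: "('v, 'e) pre_digraph \<Rightarrow> 'e set \<Rightarrow> bool" where
  "nondisconnecting \<Gamma> \<E> \<longleftrightarrow>
     \<E> \<subseteq> arcs \<Gamma> \<and> Digraph_Component.connected (\<Gamma>\<lparr>arcs := arcs \<Gamma> - \<E>\<rparr>)"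

text \<open>
  The predicate \<^const>\<open>Digraph_Component.spanning_tree\<close> only excludes directed cycles, so it does
  not apply to the underlying undirected graph.
\<close>

definition spanning_tree_edges :: "('v, 'e) pre_digraph \<Rightarrow> 'e set \<Rightarrow> bool" where
  "spanning_tree_edges \<Gamma> T \<longleftrightarrow>
     T \<subseteq> arcs \<Gamma> \<and> Digraph_Component.connected (\<Gamma>\<lparr>arcs := T\<rparr>) \<and>
     (\<nexists>\<gamma>. undirected_cycle (\<Gamma>\<lparr>arcs := T\<rparr>) \<gamma>)"

datatype ('v, 'e) sub_vertex = Original 'v | Exceptional 'e

datatype 'e sub_edge = Whole 'e | First_Half 'e | Second_Half 'e

fun sub_tail :: "('v, 'e) pre_digraph \<Rightarrow> 'e sub_edge \<Rightarrow> ('v, 'e) sub_vertex" where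
  "sub_tail \<Gamma> (Whole e) = Original (tail \<Gamma> e)"
| "sub_tail \<Gamma> (First_Half e) = Original (tail \<Gamma> e)"
| "sub_tail \<Gamma> (Second_Half e) = Exceptional e"

fun sub_head :: "('v, 'e) pre_digraph \<Rightarrow> 'e sub_edge \<Rightarrow> ('v, 'e) sub_vertex" where
  "sub_head \<Gamma> (Whole e) = Original (head \<Gamma> e)"
| "sub_head \<Gamma> (First_Half e) = Exceptional e"
| "sub_head \<Gamma> (Second_Half e) = Original (head \<Gamma> e)"

definition edges_over :: "'e set \<Rightarrow> 'e \<Rightarrow> 'e sub_edge set" where
  "edges_over \<E> e = (if e \<in> \<E> then {First_Half e, Second_Half e} else {Whole e})"

definition subdivision :: "('v, 'e) pre_digraph \<Rightarrow> 'e set \<Rightarrow>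
    (('v, 'e) sub_vertex, 'e sub_edge) pre_digraph" where
  "subdivision \<Gamma> \<E> = \<lparr>verts = Original ` verts \<Gamma> \<union> Exceptional ` \<E>,
     arcs = (\<Union>e\<in>arcs \<Gamma>. edges_over \<E> e), tail = sub_tail \<Gamma>, head = sub_head \<Gamma>\<rparr>"

text \<open>
  A flow on a graph \<open>G\<close> is a pair of an orientation \<open>D\<close> of \<open>G\<close> and a function
  \<open>\<phi> :: _ \<Rightarrow> nat\<close> on edges, of which only the values on \<open>arcs D\<close> matter.
\<close>

definition flow_div :: "('v, 'e) pre_digraph \<Rightarrow> ('e \<Rightarrow> nat) \<Rightarrow> 'v \<Rightarrow> int" where
  "flow_div D \<phi> v = (\<Sum>e | e \<in> arcs D \<and> head D e = v. int (\<phi> e))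
                  - (\<Sum>e | e \<in> arcs D \<and> tail D e = v. int (\<phi> e))"

text \<open>
  Contraction of a set of edges \<open>F\<close>: vertices joined by a path in \<open>F\<close> are identified, and the
  edges of \<open>F\<close> (including loops) disappear.
\<close>

definition contraction_class :: "('v, 'e) pre_digraph \<Rightarrow> 'e set \<Rightarrow> 'v \<Rightarrow> 'v set" where
  "contraction_class D F v =
     {w \<in> verts D. v \<rightarrow>\<^sup>*\<^bsub>with_proj (mk_symmetric (D\<lparr>arcs := arcs D \<inter> F\<rparr>))\<^esub> w}"

definition contract :: "('v, 'e) pre_digraph \<Rightarrow> 'e set \<Rightarrow> ('v set, 'e) pre_digraph" where
  "contract D F = \<lparr>verts = contraction_class D F ` verts D, arcs = arcs D - F,
     tail = (\<lambda>e. contraction_class D F (tail D e)),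
     head = (\<lambda>e. contraction_class D F (head D e))\<rparr>"

definition acyclic_flow :: "('v, 'e) pre_digraph \<Rightarrow> ('e \<Rightarrow> nat) \<Rightarrow> bool" where
  "acyclic_flow D \<phi> \<longleftrightarrow> (\<nexists>p. pre_digraph.cycle (contract D {e \<in> arcs D. \<phi> e = 0}) p)"


section \<open>Cones\<close>

text \<open>
  Vectors indexed by the edges of a graph are functions vanishing outside its edge set, and
  functionals in \<open>Hom(\<int>\<^sup>E, \<int>)\<close> are identified with their vector of values on the
  standard basis.
\<close>

definition subdivided_cone :: "('w, 'd) pre_digraph \<Rightarrow> ('d \<Rightarrow> nat) \<Rightarrow> ('d \<Rightarrow> real) set" where
  "subdivided_cone D \<phi> = {x. (\<forall>e. e \<notin> arcs D \<longrightarrow> x e = 0) \<and> (\<forall>e\<in>arcs D. x e \<ge> 0) \<and>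
     (\<forall>\<gamma>. undirected_cycle D \<gamma> \<longrightarrow>
        (\<Sum>e\<in>arcs D. of_int (cycle_sign \<gamma> e) * of_nat (\<phi> e) * x e) = 0)}"

definition flow_cone :: "('v, 'e) pre_digraph \<Rightarrow> 'e set \<Rightarrow>
    (('v, 'e) sub_vertex, 'e sub_edge) pre_digraph \<Rightarrow> ('e sub_edge \<Rightarrow> nat) \<Rightarrow> ('e \<Rightarrow> real) set" where
  "flow_cone \<Gamma> \<E> D \<phi> =
     (\<lambda>x e. if e \<in> arcs \<Gamma> then \<Sum>e'\<in>edges_over \<E> e. x e' else 0) ` subdivided_cone D \<phi>"

definition pairing :: "'e set \<Rightarrow> ('e \<Rightarrow> int) \<Rightarrow> ('e \<Rightarrow> 'a) \<Rightarrow> 'a::comm_ring_1" where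
  "pairing Ed u v = (\<Sum>e\<in>Ed. of_int (u e) * v e)"

definition ray :: "('e \<Rightarrow> int) \<Rightarrow> ('e \<Rightarrow> real) set" where
  "ray r = {\<lambda>e. c * of_int (r e) | c. c \<ge> 0}"

text \<open>
  The extremal rays of a cone \<open>K\<close> in \<open>\<real>\<^sup>E\<close>, given by their primitive generators with respect to
  the lattice \<open>\<int>\<^sup>E\<close>.
\<close>

definition extremal_rays :: "'e set \<Rightarrow> ('e \<Rightarrow> real) set \<Rightarrow> ('e \<Rightarrow> int) set" where
  "extremal_rays Ed K = {r. (\<forall>e. e \<notin> Ed \<longrightarrow> r e = 0) \<and> Gcd (r ` Ed) = 1 \<and> ray r \<subseteq> K \<and>
     (\<forall>v\<in>K. \<forall>w\<in>K. v + w \<in> ray r \<longrightarrow> v \<in> ray r \<and> w \<in> ray r)}"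

definition dual_monoid :: "'e set \<Rightarrow> ('e \<Rightarrow> real) set \<Rightarrow> ('e \<Rightarrow> int) set" where
  "dual_monoid Ed K = {u. (\<forall>e. e \<notin> Ed \<longrightarrow> u e = 0) \<and> (\<forall>v\<in>K. pairing Ed u v \<ge> 0)}"

definition coordinate :: "'e \<Rightarrow> 'e \<Rightarrow> int" where
  "coordinate e\<^sub>0 = (\<lambda>e. if e = e\<^sub>0 then 1 else 0)"

text \<open>
  The functionals \<open>u'\<close> and \<open>u''\<close> attached to an edge \<open>e\<^sub>0\<close> subdivided into \<open>es\<close>, \<open>et\<close>, a spanning tree
  \<open>T\<close> containing no subdivided edge, and a cycle \<open>\<gamma>\<close> of the subdivision.
\<close>

definition u_prime :: "('e sub_edge \<Rightarrow> nat) \<Rightarrow> 'e set \<Rightarrow> ('e sub_edge \<times> bool) list \<Rightarrow>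
    'e \<Rightarrow> 'e sub_edge \<Rightarrow> 'e \<Rightarrow> int" where
  "u_prime \<phi> T \<gamma> e\<^sub>0 es e =
     (if e = e\<^sub>0 then - int (\<phi> es)
      else if e \<in> T then - (cycle_sign \<gamma> (Whole e) * int (\<phi> (Whole e))) else 0)"

definition u_second :: "('e sub_edge \<Rightarrow> nat) \<Rightarrow> 'e set \<Rightarrow> ('e sub_edge \<times> bool) list \<Rightarrow>
    'e \<Rightarrow> 'e sub_edge \<Rightarrow> 'e \<Rightarrow> int" where
  "u_second \<phi> T \<gamma> e\<^sub>0 et e =
     (if e = e\<^sub>0 then int (\<phi> et)
      else if e \<in> T then cycle_sign \<gamma> (Whole e) * int (\<phi> (Whole e)) else 0)"


section \<open>Localization of commutative rings\<close>

text \<open>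
  \<open>S\<close> is a multiplicative subset of the commutative ring \<open>R\<close>; \<open>(a, s)\<close> stands for the fraction
  \<open>a/s\<close>. The operations are those induced on equivalence classes by the usual ones on fractions.
\<close>

definition frac_rel :: "('a, 'm) ring_scheme \<Rightarrow> 'a set \<Rightarrow> (('a \<times> 'a) \<times> ('a \<times> 'a)) set" where
  "frac_rel R S = {((a, s), (b, t)). a \<in> carrier R \<and> b \<in> carrier R \<and> s \<in> S \<and> t \<in> S \<and>
     (\<exists>w\<in>S. w \<otimes>\<^bsub>R\<^esub> (a \<otimes>\<^bsub>R\<^esub> t) = w \<otimes>\<^bsub>R\<^esub> (b \<otimes>\<^bsub>R\<^esub> s))}"

definition frac :: "('a, 'm) ring_scheme \<Rightarrow> 'a set \<Rightarrow> 'a \<Rightarrow> 'a \<Rightarrow> ('a \<times> 'a) set" where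
  "frac R S a s = frac_rel R S `` {(a, s)}"

definition localization :: "('a, 'm) ring_scheme \<Rightarrow> 'a set \<Rightarrow> ('a \<times> 'a) set ring" where
  "localization R S = \<lparr>carrier = (carrier R \<times> S) // frac_rel R S,
     mult = (\<lambda>X Y. \<Union>(a, s)\<in>X. \<Union>(b, t)\<in>Y. frac R S (a \<otimes>\<^bsub>R\<^esub> b) (s \<otimes>\<^bsub>R\<^esub> t)),
     one = frac R S \<one>\<^bsub>R\<^esub> \<one>\<^bsub>R\<^esub>,
     zero = frac R S \<zero>\<^bsub>R\<^esub> \<one>\<^bsub>R\<^esub>,
     add = (\<lambda>X Y. \<Union>(a, s)\<in>X. \<Union>(b, t)\<in>Y.
       frac R S ((a \<otimes>\<^bsub>R\<^esub> t) \<oplus>\<^bsub>R\<^esub> (b \<otimes>\<^bsub>R\<^esub> s)) (s \<otimes>\<^bsub>R\<^esub> t))\<rparr>"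

definition localization_map :: "('a, 'm) ring_scheme \<Rightarrow> 'a set \<Rightarrow> 'a \<Rightarrow> ('a \<times> 'a) set" where
  "localization_map R S a = frac R S a \<one>\<^bsub>R\<^esub>"


section \<open>The toric algebras\<close>

text \<open>
  The group algebra \<open>k[M]\<close> is \<^typ>\<open>('e \<Rightarrow> int) \<Rightarrow>\<^sub>0 'k\<close> with its convolution product, where the
  exponents are added pointwise; \<open>A\<^sub>K\<close> is the subalgebra of elements with exponents in \<open>K\<^sup>\<or> \<inter> M\<close>.
  Similarly, \<open>A\<^sub>K[x, y]\<close> consists of the finitely supported families of coefficients in \<open>A\<^sub>K\<close> indexed by
  the exponents \<open>(i, j)\<close> of the monomials in \<open>x\<close> and \<open>y\<close>.
\<close>

type_synonym ('e, 'k) group_algebra = "('e \<Rightarrow> int) \<Rightarrow>\<^sub>0 'k"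

type_synonym ('e, 'k) poly_xy = "(nat \<times> nat) \<Rightarrow>\<^sub>0 ('e, 'k) group_algebra"

definition subring_record :: "'a::comm_ring_1 set \<Rightarrow> 'a ring" where
  "subring_record S = \<lparr>carrier = S, mult = (*), one = 1, zero = 0, add = (+)\<rparr>"

definition char_alg :: "('e \<Rightarrow> int) \<Rightarrow> ('e, 'k::field) group_algebra" where
  "char_alg u = Poly_Mapping.single u 1"

definition A_cone :: "'e set \<Rightarrow> ('e \<Rightarrow> real) set \<Rightarrow> ('e, 'k::field) group_algebra ring" where
  "A_cone Ed K = subring_record {f. Poly_Mapping.keys f \<subseteq> dual_monoid Ed K}"

definition A_cone_xy :: "'e set \<Rightarrow> ('e \<Rightarrow> real) set \<Rightarrow> ('e, 'k::field) poly_xy ring" where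
  "A_cone_xy Ed K = subring_record {P. \<forall>m. Poly_Mapping.lookup P m \<in> carrier (A_cone Ed K)}"

definition poly_const :: "('e, 'k::field) group_algebra \<Rightarrow> ('e, 'k) poly_xy" where
  "poly_const f = Poly_Mapping.single (0, 0) f"

definition poly_x :: "('e, 'k::field) poly_xy" where
  "poly_x = Poly_Mapping.single (1, 0) 1"

definition poly_y :: "('e, 'k::field) poly_xy" where
  "poly_y = Poly_Mapping.single (0, 1) 1"

definition tau_relations ::
    "'e set \<Rightarrow> ('e \<Rightarrow> real) set \<Rightarrow> 'e \<Rightarrow> ('e, 'k::field) poly_xy set" where
  "tau_relations Ed K e\<^sub>0 =
     Idl\<^bsub>A_cone_xy Ed K\<^esub> {poly_x * poly_y - poly_const (char_alg (coordinate e\<^sub>0))}"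

definition A_tau ::
    "'e set \<Rightarrow> ('e \<Rightarrow> real) set \<Rightarrow> 'e \<Rightarrow> ('e, 'k::field) poly_xy set ring" where
  "A_tau Ed K e\<^sub>0 = A_cone_xy Ed K Quot tau_relations Ed K e\<^sub>0"

definition tau_class ::
    "'e set \<Rightarrow> ('e \<Rightarrow> real) set \<Rightarrow> 'e \<Rightarrow> ('e, 'k::field) poly_xy \<Rightarrow> ('e, 'k) poly_xy set" where
  "tau_class Ed K e\<^sub>0 P = tau_relations Ed K e\<^sub>0 +>\<^bsub>A_cone_xy Ed K\<^esub> P"

definition tau_y :: "'e set \<Rightarrow> ('e \<Rightarrow> real) set \<Rightarrow> 'e \<Rightarrow> ('e, 'k::field) poly_xy set" where
  "tau_y Ed K e\<^sub>0 = tau_class Ed K e\<^sub>0 poly_y"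

definition tau_char ::
    "'e set \<Rightarrow> ('e \<Rightarrow> real) set \<Rightarrow> 'e \<Rightarrow> ('e \<Rightarrow> int) \<Rightarrow> ('e, 'k::field) poly_xy set" where
  "tau_char Ed K e\<^sub>0 u = tau_class Ed K e\<^sub>0 (poly_const (char_alg u))"

definition ray_characters ::
    "'e set \<Rightarrow> ('e \<Rightarrow> real) set \<Rightarrow> 'e \<Rightarrow> ('e \<Rightarrow> int) \<Rightarrow> ('e, 'k::field) poly_xy set set" where
  "ray_characters Ed K e\<^sub>0 r = tau_char Ed K e\<^sub>0 ` {u \<in> dual_monoid Ed K. pairing Ed u r = 0}"

text \<open>\<open>ray_ideal Ed K e\<^sub>0 r n\<close> is the ideal \<open>I\<^sup>(\<^sup>n\<^sup>)\<close> attached to \<open>e\<^sub>0\<close> and \<open>r\<close>.\<close>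

definition ray_ideal :: "'e set \<Rightarrow> ('e \<Rightarrow> real) set \<Rightarrow> 'e \<Rightarrow> ('e \<Rightarrow> int) \<Rightarrow> nat \<Rightarrow>
    ('e, 'k::field) poly_xy set set" where
  "ray_ideal Ed K e\<^sub>0 r n =
     (let A = A_tau Ed K e\<^sub>0;
          S = ray_characters Ed K e\<^sub>0 r;
          L = localization A S
      in {f \<in> carrier A. localization_map A S f \<in>
            Idl\<^bsub>L\<^esub> {localization_map A S (tau_y Ed K e\<^sub>0) [^]\<^bsub>L\<^esub> n}})"

definition ideal_power :: "('a, 'm) ring_scheme \<Rightarrow> 'a set \<Rightarrow> nat \<Rightarrow> 'a set" where
  "ideal_power R I n = I [^]\<^bsub>ideals_set R\<^esub> n"

end

theory Submission
  imports Defs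
begin

text \<open>
  In \<open>k[M][y, y\<inverse>]\<close>, where \<open>x = \<chi>\<^sup>e y\<inverse>\<close> with \<open>e\<close> the coordinate functional of \<open>e\<^sub>0\<close>, all ideals involved
  are spanned by characters \<open>\<chi>\<^sup>v y\<^sup>j\<close>. A character in \<open>I\<^sup>(\<^sup>n\<^sup>)\<close> for a ray \<open>r\<close> satisfies
  \<open>v(r) + min(j - n, 0) e(r) \<ge> 0\<close>. A functional that is nonnegative on all extremal rays is
  nonnegative on \<open>K\<close>, so these inequalities together say that \<open>\<chi>\<^sup>v y\<^sup>j\<close> is a multiple of the expected
  generator. If \<open>e\<^sub>0\<close> is subdivided, \<open>u'\<close> and \<open>u''\<close> are the lengths of the two halves of \<open>e\<^sub>0\<close>, so that
  \<open>u' + u'' = e\<close>, and one of the two halves has length \<open>0\<close> on every extremal ray: a point of the cone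
  is a potential on the graph that increases along the flow, and a potential \<open>f\<close> with value \<open>c\<close>
  strictly between its values at the ends of \<open>e\<^sub>0\<close> splits as \<open>min(f, c) + (max(f, c) - c)\<close>.
\<close>

section \<open>Potentials\<close>

text \<open>The ring theory reduces to exponents because clearing denominators turns membership in a
  ray ideal into an equation s f = a y^n in \<open>A_tau\<close>, and the map to the Laurent algebra
  is injective, so coefficients can be compared. The term min(j - n, 0) appears because only
  negative powers of y cost something: for j < 0 the character \<chi>^v y^j equals \<chi>^(v + j e)
  x^(-j). Only this necessary condition is derived for the ray ideals; the reverse inclusions are
  checked on generators.

  The geometric obstacle is that \<open>K\<close> is an image of the cone \<open>C\<close> of the
  subdivision, while only \<open>C\<close> is given by equations. \<open>C\<close> lies in an
  orthant and its equations are integral, so a vector of minimal support yields an integral extremal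
  generator. Extremality passes to \<open>K\<close> because the projection is injective on
  \<open>C\<close>. This rests on the connectedness of the graph without \<E> and on divergence -1
  at the exceptional vertices.\<close>

lemma traversals_simps [simp]:
  "verts (traversals D) = verts D" "arcs (traversals D) = arcs D \<times> UNIV"
  "tail (traversals D) (e, b) = (if b then tail D e else head D e)"
  "head (traversals D) (e, b) = (if b then head D e else tail D e)"
  by (simp_all add: traversals_def)

lemma traversals_restrict_simps [simp]:
  "tail (traversals (D\<lparr>arcs := F\<rparr>)) = tail (traversals D)"
  "head (traversals (D\<lparr>arcs := F\<rparr>)) = head (traversals D)"
  by (simp_all add: traversals_def fun_eq_iff)

lemma wf_digraph_traversals:
  assumes "wf_digraph D" shows "wf_digraph (traversals D)"
  using assms by (auto simp: wf_digraph_def)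

text \<open>The discrete line integral of \<open>g\<close> along a walk that may run edges
  backwards.\<close>

definition signed_sum :: "('e \<Rightarrow> real) \<Rightarrow> ('e \<times> bool) list \<Rightarrow> real" where
  "signed_sum g \<gamma> = (\<Sum>(e, b)\<leftarrow>\<gamma>. if b then g e else - g e)"

lemma signed_sum_simps [simp]:
  "signed_sum g [] = 0"
  "signed_sum g ((e, b) # \<gamma>) = (if b then g e else - g e) + signed_sum g \<gamma>"
  by (simp_all add: signed_sum_def)

lemma cas_restrict:
  "pre_digraph.cas (traversals (D\<lparr>arcs := F\<rparr>)) u p v \<longleftrightarrow> pre_digraph.cas (traversals D) u p v"
  by (induction p arbitrary: u) (auto simp: pre_digraph.cas.simps)

lemma awalk_verts_restrict:
  "pre_digraph.awalk_verts (traversals (D\<lparr>arcs := F\<rparr>)) u p =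
   pre_digraph.awalk_verts (traversals D) u p"
  by (simp add: pre_digraph.awalk_verts_conv)

text \<open>On \<open>F\<close> the function \<open>g\<close> is the coboundary of \<open>f\<close>,
  so each step, in either direction, contributes the change of \<open>f\<close>, and these changes
  cancel along the walk. The set \<open>F\<close> is a parameter because potentials are built one
  edge at a time.\<close>

lemma signed_sum_telescope:
  assumes "pre_digraph.cas (traversals D) u p v" "fst ` set p \<subseteq> F"
    and "\<And>e. e \<in> F \<Longrightarrow> f (head D e) - f (tail D e) = g e"
  shows "signed_sum g p = f v - f u"
  using assms(1,2)
proof (induction p arbitrary: u)
  case Nil
  then show ?case by (simp add: pre_digraph.cas.simps)
next
  case (Cons a p)
  obtain e b where a: "a = (e, b)" by (cases a)
  have "signed_sum g p = f v - f (if b then head D e else tail D e)"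
    using Cons by (auto simp: pre_digraph.cas.simps a)
  then show ?case using Cons.prems assms(3)[of e] by (auto simp: pre_digraph.cas.simps a)
qed

lemma cycle_sign_Cons:
  assumes "e \<notin> fst ` set \<gamma>"
  shows "cycle_sign ((e, b) # \<gamma>) e' = (if e' = e then (if b then 1 else -1) else cycle_sign \<gamma> e')"
  using assms by (force simp: cycle_sign_def)

text \<open>Every edge occurs at most once, so no two steps compete for its sign. This links the sum
  over all edges, in which the cone is stated, to the sum over steps, which telescopes.\<close>

lemma sum_cycle_sign:
  fixes g :: "'e \<Rightarrow> real"
  assumes "finite A" "fst ` set \<gamma> \<subseteq> A" "distinct (map fst \<gamma>)"
  shows "(\<Sum>e\<in>A. of_int (cycle_sign \<gamma> e) * g e) = signed_sum g \<gamma>"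
  using assms(2,3)
proof (induction \<gamma>)
  case Nil
  then show ?case by (simp add: cycle_sign_def)
next
  case (Cons a \<gamma>)
  obtain e b where a: "a = (e, b)" by (cases a)
  have ne: "e \<notin> fst ` set \<gamma>" and e: "e \<in> A" using Cons.prems by (auto simp: a)
  have z: "cycle_sign \<gamma> e = 0" using ne by (force simp: cycle_sign_def)
  have "(\<Sum>e'\<in>A. of_int (cycle_sign (a # \<gamma>) e') * g e') =
    (\<Sum>e'\<in>A. of_int (cycle_sign \<gamma> e') * g e' + (if e' = e then (if b then g e else - g e) else 0))"
    unfolding a using z by (intro sum.cong) (auto simp: cycle_sign_Cons[OF ne])
  also have "\<dots> = signed_sum g (a # \<gamma>)"
    using Cons e assms(1) by (simp add: sum.distrib a)
  finally show ?case .
qed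

lemma undirected_cycle_arcs:
  assumes "undirected_cycle D \<gamma>"
  shows "fst ` set \<gamma> \<subseteq> arcs D" "distinct (map fst \<gamma>)"
    "\<exists>u. pre_digraph.cas (traversals D) u \<gamma> u"
  using assms by (auto simp: undirected_cycle_def pre_digraph.cycle_def pre_digraph.awalk_def)

lemma sum_cycle_sign_potential:
  fixes g :: "'e \<Rightarrow> real"
  assumes "undirected_cycle D \<gamma>" "finite (arcs D)"
    and "\<And>e. e \<in> arcs D \<Longrightarrow> f (head D e) - f (tail D e) = g e"
  shows "(\<Sum>e\<in>arcs D. of_int (cycle_sign \<gamma> e) * g e) = 0"
proof -
  obtain u where "pre_digraph.cas (traversals D) u \<gamma> u"
    using undirected_cycle_arcs[OF assms(1)] by blast
  then have "signed_sum g \<gamma> = f u - f u"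
    using undirected_cycle_arcs[OF assms(1)] assms(3) by (intro signed_sum_telescope)
  then show ?thesis
    using sum_cycle_sign[OF assms(2) undirected_cycle_arcs(1,2)[OF assms(1)]] by simp
qed

text \<open>A repeated edge would make the path return to the first end of that edge.\<close>

lemma apath_traversals_distinct:
  assumes "pre_digraph.apath (traversals D) u p v"
  shows "distinct (map fst p)"
proof -
  have "distinct (pre_digraph.awalk_verts (traversals D) u p)" "pre_digraph.cas (traversals D) u p v"
    using assms by (auto simp: pre_digraph.apath_def pre_digraph.awalk_def)
  then show ?thesis
  proof (induction p arbitrary: u)
    case Nil
    then show ?case by simp
  next
    case (Cons a p)
    obtain e b where a: "a = (e, b)" by (cases a)
    \<comment> \<open>The start \<open>w\<close> is arbitrary because the rest of the path starts at
      the head of \<open>a\<close>. Both ends of an edge occur among the vertices, whatever the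
      direction of travel.\<close>
    have ends: "{tail D (fst c), head D (fst c)} \<subseteq> set (pre_digraph.awalk_verts (traversals D) w p)"
      if "c \<in> set p" "pre_digraph.cas (traversals D) w p v" for c w
      using that
    proof (induction p arbitrary: w)
      case (Cons d p)
      obtain e' b' where d: "d = (e', b')" by (cases d)
      have hd: "z \<in> set (pre_digraph.awalk_verts (traversals D) z q)"
        if "pre_digraph.cas (traversals D) z q v" for z q
        using that by (cases q) (auto simp: pre_digraph.cas.simps pre_digraph.awalk_verts.simps)
      show ?case
      proof (cases "c = d")
        case True
        then show ?thesis using Cons.prems(2) hd[of "head (traversals D) d" p]
          by (auto simp: d pre_digraph.cas.simps pre_digraph.awalk_verts.simps split: if_splits)
      next
        case False
        then show ?thesis using Cons
          by (auto simp: pre_digraph.cas.simps pre_digraph.awalk_verts.simps)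
      qed
    qed simp
    have "e \<notin> fst ` set p"
      using ends[of _ "head (traversals D) a"] Cons.prems
      by (auto simp: a pre_digraph.cas.simps pre_digraph.awalk_verts.simps split: if_splits) 
    then show ?case using Cons
      by (auto simp: a pre_digraph.cas.simps pre_digraph.awalk_verts.simps)
  qed
qed

text \<open>
  Edges are added one at a time: an edge closing a cycle already satisfies the relation, and for
  any other edge the potential is shifted on the component of its head.
\<close>

lemma potential_exists:
  assumes wf: "wf_digraph D" and "finite F" "F \<subseteq> arcs D"
    and cyc: "\<And>\<gamma>. undirected_cycle D \<gamma> \<Longrightarrow> signed_sum g \<gamma> = 0"
  shows "\<exists>f. \<forall>e\<in>F. f (head D e) - f (tail D e) = g e"
  using assms(2,3)
proof (induction F)
  case (insert e F)
  then obtain f where f: "\<And>e. e \<in> F \<Longrightarrow> f (head D e) - f (tail D e) = g e" by auto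
  define G where "G = traversals (D\<lparr>arcs := F\<rparr>)"
  have G: "tail G = tail (traversals D)" "head G = head (traversals D)"
    "verts G = verts D" "arcs G = F \<times> UNIV"
    by (simp_all add: G_def)
  have wfG: "wf_digraph G" unfolding G_def
    using wf insert.prems by (intro wf_digraph_traversals) (auto simp: wf_digraph_def)
  then interpret G: wf_digraph G .
  have e: "e \<in> arcs D" "head D e \<in> verts D" "tail D e \<in> verts D"
    using insert.prems wf by (auto simp: wf_digraph_def)
  define C where "C = {v. head D e \<rightarrow>\<^sup>*\<^bsub>G\<^esub> v}"
  show ?case
  proof (cases "tail D e \<in> C")
    case True
    then obtain p where p: "G.apath (head D e) p (tail D e)"
      by (auto simp: C_def G.reachable_apath)
    have pF: "fst ` set p \<subseteq> F" and cas: "pre_digraph.cas (traversals D) (head D e) p (tail D e)"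
      and dist: "distinct (pre_digraph.awalk_verts (traversals D) (head D e) p)"
      using p
      by (auto simp: pre_digraph.apath_def pre_digraph.awalk_def G_def cas_restrict awalk_verts_restrict)
    \<comment> \<open>The path leads from the head of \<open>e\<close> back to its tail and uses
      only edges of \<open>F\<close>, which does not contain \<open>e\<close>.\<close>
    have "undirected_cycle D ((e, True) # p)"
      unfolding undirected_cycle_def pre_digraph.cycle_def pre_digraph.awalk_def
      using insert.hyps e pF cas dist apath_traversals_distinct[OF p[unfolded G_def]]
        subset_trans[OF pF, of "arcs D"] insert.prems
      by (auto simp: pre_digraph.cas.simps pre_digraph.awalk_verts.simps image_subset_iff intro!: exI[of _ "tail D e"])
    then have "g e + signed_sum g p = 0" using cyc by fastforce
    moreover have "signed_sum g p = f (tail D e) - f (head D e)"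
      using cas pF f by (rule signed_sum_telescope)
    ultimately show ?thesis using f by (intro exI[of _ f]) auto
  next
    case False
    have headC: "head D e \<in> C" using e by (auto simp: C_def G)
    \<comment> \<open>\<open>G\<close> contains both traversals of \<open>e'\<close>, so
      \<open>C\<close> contains both ends of an edge of \<open>F\<close> or neither, and a shift on
      \<open>C\<close> leaves the increments on \<open>F\<close> alone.\<close>
    have inv: "tail D e' \<in> C \<longleftrightarrow> head D e' \<in> C" if "e' \<in> F" for e'
    proof -
      have "(e', b) \<in> arcs G" for b using that by (simp add: G)
      then have "tail G (e', b) \<rightarrow>\<^bsub>G\<^esub> head G (e', b)" for b
        by (intro G.in_arcs_imp_in_arcs_ends)
      from this[of True] this[of False] show ?thesis
        by (auto simp: C_def G intro: G.reachable_adj_trans)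
    qed
    \<comment> \<open>The error of \<open>f\<close> on \<open>e\<close>. The shift applies at the
      head of \<open>e\<close> but not at its tail, hence corrects exactly this error.\<close>
    define k where "k = g e - (f (head D e) - f (tail D e))"
    have "(f (head D e') + (if head D e' \<in> C then k else 0)) -
        (f (tail D e') + (if tail D e' \<in> C then k else 0)) = g e'" if "e' \<in> insert e F" for e'
      using that f[of e'] inv[of e'] False headC by (auto simp: k_def)
    then show ?thesis by (intro exI[of _ "\<lambda>v. f v + (if v \<in> C then k else 0)"]) auto
  qed
qed auto

text \<open>A real cochain that vanishes on every cycle of a graph is a coboundary. Points of the
  cone can then be built and cut by manipulating functions on vertices, without inspecting
  cycles.\<close>

lemma subdivided_cone_iff_potential:
  assumes "fin_digraph D"
  shows "x \<in> subdivided_cone D \<phi> \<longleftrightarrow>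
    (\<forall>e. e \<notin> arcs D \<longrightarrow> x e = 0) \<and> (\<forall>e\<in>arcs D. x e \<ge> 0) \<and>
    (\<exists>f. \<forall>e\<in>arcs D. f (head D e) - f (tail D e) = real (\<phi> e) * x e)"
proof -
  interpret fin_digraph D by fact
  have sum: "(\<Sum>e\<in>arcs D. of_int (cycle_sign \<gamma> e) * of_nat (\<phi> e) * x e)
      = signed_sum (\<lambda>e. real (\<phi> e) * x e) \<gamma>" if "undirected_cycle D \<gamma>" for \<gamma>
    using sum_cycle_sign[OF finite_arcs undirected_cycle_arcs(1,2)[OF that]]
    by (simp add: mult.assoc)
  have "(\<forall>\<gamma>. undirected_cycle D \<gamma> \<longrightarrow>
        (\<Sum>e\<in>arcs D. of_int (cycle_sign \<gamma> e) * of_nat (\<phi> e) * x e) = 0) \<longleftrightarrow>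
    (\<exists>f. \<forall>e\<in>arcs D. f (head D e) - f (tail D e) = real (\<phi> e) * x e)" (is "?l \<longleftrightarrow> ?r")
  proof
    assume ?l
    then show ?r using sum
      by (intro potential_exists[OF wf_digraph finite_arcs order_refl]) auto
  next
    assume ?r
    then obtain f where "\<And>e. e \<in> arcs D \<Longrightarrow> f (head D e) - f (tail D e) = real (\<phi> e) * x e"
      by blast
    then show ?l using sum_cycle_sign_potential[OF _ finite_arcs, of _ f "\<lambda>e. real (\<phi> e) * x e"]
      by (auto simp: mult.assoc)
  qed
  then show ?thesis by (auto simp: subdivided_cone_def)
qed


section \<open>Extremal rays of rational cones\<close>

text \<open>Over \<rat> the set \<open>{c}\<close> is independent, so a linear map with value 1 on
  \<open>c\<close> extends to all of \<real>.\<close>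

lemma rational_functional_exists:
  fixes c :: real
  assumes "c \<noteq> 0"
  obtains l :: "real \<Rightarrow> rat" where "l c = 1" "\<And>x y. l (x + y) = l x + l y"
    "\<And>q x. l (of_rat q * x) = q * l x"
proof -
  interpret vector_space_pair "\<lambda>q x. of_rat q * x :: real" "(*) :: rat \<Rightarrow> rat \<Rightarrow> rat"
    by unfold_locales (simp_all add: algebra_simps of_rat_add of_rat_mult)
  have ind: "vs1.independent {c}" using assms by (simp add: vs1.dependent_single)
  interpret l: Vector_Spaces.linear "\<lambda>q x. of_rat q * x :: real" "(*) :: rat \<Rightarrow> rat \<Rightarrow> rat" "construct {c} (\<lambda>_. 1)"
    by (rule linear_construct[OF ind])
  show ?thesis
    using that[of "construct {c} (\<lambda>_. 1)"] construct_basis[OF ind, of c] l.add l.scale by auto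
qed

lemma common_denominator_exists:
  fixes q :: "'i \<Rightarrow> rat"
  assumes "finite I"
  shows "\<exists>d>0. \<forall>i\<in>I. \<exists>z. of_int d * q i = of_int z"
  using assms
proof (induction I)
  case empty
  then show ?case by (intro exI[of _ 1]) auto
next
  case (insert i I)
  then obtain d where d: "d > 0" "\<forall>i\<in>I. \<exists>z. of_int d * q i = of_int z" by auto
  obtain a b where ab: "q i = of_int a / of_int b" "b > 0"
    by (metis quotient_of_unique quotient_of_div quotient_of_denom_pos surj_pair)
  have "\<exists>z. of_int (d * b) * q j = of_int z" if j: "j \<in> insert i I" for j
  proof (cases "j = i")
    case True
    then show ?thesis using ab by (intro exI[of _ "d * a"]) simp
  next
    case False
    then obtain z where "of_int d * q j = of_int z" using d j by auto
    then have "of_int (d * b) * q j = of_int (b * z)" by (simp add: mult.commute mult.left_commute)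
    then show ?thesis by blast
  qed
  then show ?case using d(1) ab(2) by (intro exI[of _ "d * b"]) auto
qed

text \<open>Applying a \<open>\<rat>\<close>-linear functional \<open>\<real> \<rightarrow> \<rat>\<close> to the coordinates preserves the equations.\<close>

lemma integer_solution_exists:
  fixes A :: "('i \<Rightarrow> int) set" and v :: "'i \<Rightarrow> real"
  assumes "finite I" and sol: "\<And>a. a \<in> A \<Longrightarrow> (\<Sum>i\<in>I. of_int (a i) * v i) = 0"
    and k: "k \<in> I" "v k \<noteq> 0"
  obtains z :: "'i \<Rightarrow> int" where "\<And>a. a \<in> A \<Longrightarrow> (\<Sum>i\<in>I. a i * z i) = 0"
    "\<And>i. v i = 0 \<Longrightarrow> z i = 0" "\<And>i. i \<notin> I \<Longrightarrow> z i = 0" "z k \<noteq> 0"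
proof -
  \<comment> \<open>Normalizing at \<open>v k\<close> ensures that the integral solution does not
    vanish at \<open>k\<close>.\<close>
  obtain l :: "real \<Rightarrow> rat" where l: "l (v k) = 1" "\<And>x y. l (x + y) = l x + l y"
    "\<And>q x. l (of_rat q * x) = q * l x"
    using rational_functional_exists[OF k(2)] by blast
  have l0: "l 0 = 0" using l(3)[of 0 0] by simp
  have lsum: "l (sum h I) = (\<Sum>i\<in>I. l (h i))" for h
    using assms(1) by (induction I) (auto simp: l0 l(2))
  obtain d where d: "d > 0" "\<forall>i\<in>I. \<exists>z. of_int d * l (v i) = of_int z"
    using common_denominator_exists[OF assms(1), of "\<lambda>i. l (v i)"] by blast
  then obtain z where z: "\<And>i. i \<in> I \<Longrightarrow> of_int d * l (v i) = of_int (z i)" by metis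
  have "(\<Sum>i\<in>I. a i * z i) = 0" if "a \<in> A" for a
  proof -
    have "of_int (\<Sum>i\<in>I. a i * z i) = (\<Sum>i\<in>I. of_int (a i) * (of_int d * l (v i)))"
      by (simp add: z)
    also have "\<dots> = of_int d * (\<Sum>i\<in>I. of_int (a i) * l (v i))"
      by (simp add: sum_distrib_left mult.left_commute)
    also have "(\<Sum>i\<in>I. of_int (a i) * l (v i)) = l (\<Sum>i\<in>I. of_int (a i) * v i)"
      using l(3)[of "of_int _"] by (simp add: lsum)
    also have "\<dots> = 0" using sol[OF that] by (simp add: l0)
    finally show ?thesis by (simp flip: of_int_sum of_int_mult)
  qed
  moreover have "z i = 0" if "i \<in> I" "v i = 0" for i using z[OF that(1)] that l0 by simp
  moreover have "z k \<noteq> 0" using z[OF k(1)] l(1) d(1) by auto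
  ultimately show ?thesis using k by (intro that[of "\<lambda>i. if i \<in> I then z i else 0"]) auto
qed

definition rational_cone :: "'i set \<Rightarrow> ('i \<Rightarrow> int) set \<Rightarrow> ('i \<Rightarrow> real) set" where
  "rational_cone I A = {x. (\<forall>i. i \<notin> I \<longrightarrow> x i = 0) \<and> (\<forall>i\<in>I. x i \<ge> 0) \<and>
     (\<forall>a\<in>A. (\<Sum>i\<in>I. of_int (a i) * x i) = 0)}"

text \<open>
  A vector of minimal support on which the functional is negative spans the space of solutions
  supported there: otherwise it could be moved inside this space, without changing the functional,
  until a coordinate vanishes.
\<close>

lemma rational_cone_extremal_generator:
  fixes c :: "'i \<Rightarrow> real"
  assumes fin: "finite I" and v\<^sub>0: "v\<^sub>0 \<in> rational_cone I A" "(\<Sum>i\<in>I. c i * v\<^sub>0 i) < 0"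
  obtains z :: "'i \<Rightarrow> int" where "(\<lambda>i. of_int (z i)) \<in> rational_cone I A"
    "(\<Sum>i\<in>I. c i * of_int (z i)) < 0"
    "\<And>x. x \<in> rational_cone I A \<Longrightarrow> (\<And>i. z i = 0 \<Longrightarrow> x i = 0) \<Longrightarrow> \<exists>t\<ge>0. x = (\<lambda>i. t * of_int (z i))"
proof -
  define L where "L x = (\<Sum>i\<in>I. c i * x i)" for x
  have L_lin: "L (\<lambda>i. x i + t * y i) = L x + t * L y" for x y t
    by (simp add: L_def sum.distrib sum_distrib_left algebra_simps)
  have eq_lin: "(\<Sum>i\<in>I. of_int (a i) * (x i + t * y i)) =
      (\<Sum>i\<in>I. of_int (a i) * x i) + t * (\<Sum>i\<in>I. of_int (a i) * y i)"
    for a :: "'i \<Rightarrow> int" and x y :: "'i \<Rightarrow> real" and t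
    by (simp add: sum.distrib sum_distrib_left algebra_simps)
  let ?P = "\<lambda>x. x \<in> rational_cone I A \<and> L x < 0"
  let ?supp = "\<lambda>x. card {i \<in> I. x i \<noteq> (0::real)}"
  obtain v where v: "v \<in> rational_cone I A" "L v < 0"
    and min: "\<And>x. ?P x \<Longrightarrow> ?supp v \<le> ?supp x"
    using ex_has_least_nat[of ?P v\<^sub>0 ?supp] v\<^sub>0 by (auto simp: L_def)
  have v_nonneg: "v i \<ge> 0" for i using v(1) by (cases "i \<in> I") (auto simp: rational_cone_def)
  have span: "\<exists>t. y = (\<lambda>i. t * v i)"
    if y: "\<And>a. a \<in> A \<Longrightarrow> (\<Sum>i\<in>I. of_int (a i) * y i) = 0" "\<And>i. v i = 0 \<Longrightarrow> y i = 0" for y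
  proof (rule ccontr)
    assume no: "\<nexists>t. y = (\<lambda>i. t * v i)"
    \<comment> \<open>The multiple of \<open>v\<close> is chosen to make \<open>L\<close> vanish. As
      \<open>y\<close> is not proportional to \<open>v\<close>, a nonzero direction in the kernel of
      \<open>L\<close> remains.\<close>
    define w\<^sub>0 where "w\<^sub>0 i = y i + (- (L y / L v)) * v i" for i
    have w\<^sub>0: "(\<Sum>i\<in>I. of_int (a i) * w\<^sub>0 i) = 0" if "a \<in> A" for a
      using y(1)[OF that] v(1) that unfolding w\<^sub>0_def eq_lin by (auto simp: rational_cone_def)
    have Lw\<^sub>0: "L w\<^sub>0 = 0"
      using v(2) L_lin[of y "- (L y / L v)" v] by (simp add: w\<^sub>0_def[abs_def])
    have "\<exists>k. w\<^sub>0 k \<noteq> 0"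
    proof (rule ccontr)
      assume "\<nexists>k. w\<^sub>0 k \<noteq> 0"
      then have "y = (\<lambda>i. (L y / L v) * v i)" by (auto simp: w\<^sub>0_def)
      with no show False by blast
    qed
    then obtain k where k: "w\<^sub>0 k \<noteq> 0" ..
    \<comment> \<open>The sign makes coordinate \<open>k\<close> negative, so that moving from
      \<open>v\<close> along \<open>w\<close> must eventually leave the orthant.\<close>
    define w where "w i = - sgn (w\<^sub>0 k) * w\<^sub>0 i" for i
    have wk: "w k < 0" using k by (auto simp: w_def sgn_real_def)
    have w: "(\<Sum>i\<in>I. of_int (a i) * w i) = 0" if "a \<in> A" for a
      using w\<^sub>0[OF that] eq_lin[of a "\<lambda>_. 0" "- sgn (w\<^sub>0 k)" w\<^sub>0] by (simp add: w_def)
    have Lw: "L w = 0"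
      using Lw\<^sub>0 L_lin[of "\<lambda>_. 0" "- sgn (w\<^sub>0 k)" w\<^sub>0] by (simp add: w_def[abs_def] L_def)
    have supp_w: "w i = 0" if "v i = 0" for i using that y(2) by (auto simp: w_def w\<^sub>0_def)
    have kI: "k \<in> I" using wk supp_w[of k] v(1) by (auto simp: rational_cone_def)
    define N where "N = {i \<in> I. w i < 0}"
    have N: "finite N" "k \<in> N" using fin wk kI by (auto simp: N_def)
    \<comment> \<open>The largest step that keeps all coordinates nonnegative; an index attaining
      the minimum drops out of the support.\<close>
    define t where "t = Min ((\<lambda>i. v i / - w i) ` N)"
    obtain j where j: "j \<in> N" "t = v j / - w j"
      using Min_in[of "(\<lambda>i. v i / - w i) ` N"] N unfolding t_def by blast
    have t_le: "t \<le> v i / - w i" if "i \<in> N" for i using N that by (auto simp: t_def)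
    have t_nonneg: "t \<ge> 0" using j v_nonneg[of j] by (auto simp: N_def divide_nonneg_neg)
    define x where "x i = v i + t * w i" for i
    have "x i \<ge> 0" for i
    proof (cases "i \<in> N")
      case True
      then have "t * - w i \<le> v i" using t_le[OF True] by (simp add: N_def field_simps)
      then show ?thesis by (simp add: x_def)
    next
      case False
      then have "w i \<ge> 0" using supp_w[of i] v(1)
        by (cases "i \<in> I") (auto simp: N_def rational_cone_def)
      then show ?thesis using t_nonneg v_nonneg[of i] by (simp add: x_def)
    qed
    moreover have "(\<Sum>i\<in>I. of_int (a i) * x i) = 0" if "a \<in> A" for a
      using w[OF that] v(1) that unfolding x_def eq_lin by (auto simp: rational_cone_def)
    moreover have "x i = 0" if "i \<notin> I" for i
      using that v(1) supp_w by (auto simp: x_def rational_cone_def)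
    ultimately have "x \<in> rational_cone I A" by (auto simp: rational_cone_def)
    moreover have "L x < 0" using L_lin[of v t w] Lw v(2) by (simp add: x_def[abs_def])
    ultimately have "?supp v \<le> ?supp x" using min by blast
    moreover have "{i \<in> I. x i \<noteq> 0} \<subset> {i \<in> I. v i \<noteq> 0}"
    proof
      show "{i \<in> I. x i \<noteq> 0} \<subseteq> {i \<in> I. v i \<noteq> 0}" using supp_w by (auto simp: x_def)
      have "x j = 0" using j by (simp add: x_def N_def)
      moreover have "v j \<noteq> 0" using j supp_w[of j] by (auto simp: N_def)
      ultimately show "{i \<in> I. x i \<noteq> 0} \<noteq> {i \<in> I. v i \<noteq> 0}" using j by (auto simp: N_def)
    qed
    then have "?supp x < ?supp v" using fin by (intro psubset_card_mono) auto
    ultimately show False by simp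
  qed
  have "\<exists>k\<in>I. v k \<noteq> 0" using v(2) sum.neutral[of I "\<lambda>i. c i * v i"] by (force simp: L_def)
  then obtain k where k: "k \<in> I" "v k \<noteq> 0" ..
  obtain z' :: "'i \<Rightarrow> int" where z': "\<And>a. a \<in> A \<Longrightarrow> (\<Sum>i\<in>I. a i * z' i) = 0"
    "\<And>i. v i = 0 \<Longrightarrow> z' i = 0" "z' k \<noteq> 0"
    using integer_solution_exists[where I = I and A = A and v = v and k = k] fin k v(1)
    by (auto simp: rational_cone_def)
  have "(\<Sum>i\<in>I. of_int (a i) * real_of_int (z' i)) = 0" if "a \<in> A" for a
    using z'(1)[OF that] by (simp flip: of_int_sum of_int_mult)
  then obtain t where t: "(\<lambda>i. real_of_int (z' i)) = (\<lambda>i. t * v i)"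
    using span[of "\<lambda>i. of_int (z' i)"] z'(2) by force
  have t0: "t \<noteq> 0" using fun_cong[OF t, of k] z'(3) by auto
  \<comment> \<open>The factor \<open>t\<close> is nonzero but of unknown sign; the choice of sign
    puts \<open>z\<close> into the cone.\<close>
  define z where "z i = (if t > 0 then z' i else - z' i)" for i
  have z: "real_of_int (z i) = \<bar>t\<bar> * v i" for i using fun_cong[OF t, of i] t0 by (auto simp: z_def)
  have "(\<lambda>i. of_int (z i)) \<in> rational_cone I A"
    using v(1) eq_lin[of _ "\<lambda>_. 0" "\<bar>t\<bar>" v] by (auto simp: z rational_cone_def)
  moreover have "L (\<lambda>i. of_int (z i)) < 0"
    using L_lin[of "\<lambda>_. 0" "\<bar>t\<bar>" v] v(2) t0 by (simp add: z L_def mult_pos_neg)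
  moreover have "\<exists>t\<ge>0. x = (\<lambda>i. t * of_int (z i))"
    if x: "x \<in> rational_cone I A" "\<And>i. z i = 0 \<Longrightarrow> x i = 0" for x
  proof -
    have "z i = 0" if "v i = 0" for i using z[of i] that by simp
    then obtain s where s: "x = (\<lambda>i. s * v i)" using span[of x] x by (auto simp: rational_cone_def)
    have "0 \<le> s * v k" using fun_cong[OF s, of k] x(1) k by (auto simp: rational_cone_def)
    then have "s \<ge> 0" using k v_nonneg[of k] by (simp add: zero_le_mult_iff)
    moreover have "x = (\<lambda>i. (s / \<bar>t\<bar>) * of_int (z i))" using t0 by (simp add: s z)
    ultimately show ?thesis by (intro exI[of _ "s / \<bar>t\<bar>"]) auto
  qed
  ultimately show ?thesis using that[of z] by (simp add: L_def)
qed


section \<open>Localization\<close>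

locale mult_subset = cring R for R (structure) +
  fixes S
  assumes S_subset: "S \<subseteq> carrier R"
    and one_in_S: "\<one> \<in> S"
    and mult_in_S: "\<lbrakk>s \<in> S; t \<in> S\<rbrakk> \<Longrightarrow> s \<otimes> t \<in> S"
begin

lemma S_carrier [simp]: "s \<in> S \<Longrightarrow> s \<in> carrier R"
  using S_subset by blast

lemma frac_rel_iff:
  "((a, s), (b, t)) \<in> frac_rel R S \<longleftrightarrow> a \<in> carrier R \<and> b \<in> carrier R \<and> s \<in> S \<and> t \<in> S \<and>
     (\<exists>w\<in>S. w \<otimes> (a \<otimes> t) = w \<otimes> (b \<otimes> s))"
  by (simp add: frac_rel_def)

lemma equiv_frac_rel: "equiv (carrier R \<times> S) (frac_rel R S)"
proof (rule equivI)
  show "frac_rel R S \<subseteq> (carrier R \<times> S) \<times> (carrier R \<times> S)"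
    by (auto simp: frac_rel_def)
  show "refl_on (carrier R \<times> S) (frac_rel R S)"
    using one_in_S by (auto simp: refl_on_def frac_rel_def)
  show "sym (frac_rel R S)"
    unfolding sym_def frac_rel_def by force
  show "trans (frac_rel R S)"
  proof (rule transI)
    fix x y z assume "(x, y) \<in> frac_rel R S" "(y, z) \<in> frac_rel R S"
    moreover obtain a s b t c u where xyz: "x = (a, s)" "y = (b, t)" "z = (c, u)"
      by (cases x, cases y, cases z) auto
    ultimately obtain w w' where
      c: "a \<in> carrier R" "b \<in> carrier R" "c \<in> carrier R" "s \<in> S" "t \<in> S" "u \<in> S" "w \<in> S" "w' \<in> S"
      and w: "w \<otimes> (a \<otimes> t) = w \<otimes> (b \<otimes> s)" and w': "w' \<otimes> (b \<otimes> u) = w' \<otimes> (c \<otimes> t)"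
      by (auto simp: frac_rel_iff)
    \<comment> \<open>The middle denominator \<open>t\<close> joins the multiplier: zero divisors
      are allowed, so it cannot simply be cancelled.\<close>
    have "(w \<otimes> w' \<otimes> t) \<otimes> (a \<otimes> u) = (w' \<otimes> u) \<otimes> (w \<otimes> (a \<otimes> t))"
      using c by (simp add: m_ac)
    also have "\<dots> = (w \<otimes> s) \<otimes> (w' \<otimes> (b \<otimes> u))"
      using c by (simp add: w m_ac)
    also have "\<dots> = (w \<otimes> w' \<otimes> t) \<otimes> (c \<otimes> s)"
      using c by (simp add: w' m_ac)
    finally show "(x, z) \<in> frac_rel R S"
      using c mult_in_S by (auto simp: xyz frac_rel_iff)
  qed
qed

lemma frac_eq_iff:
  assumes "a \<in> carrier R" "b \<in> carrier R" "s \<in> S" "t \<in> S"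
  shows "frac R S a s = frac R S b t \<longleftrightarrow> (\<exists>w\<in>S. w \<otimes> (a \<otimes> t) = w \<otimes> (b \<otimes> s))"
  using assms eq_equiv_class_iff[OF equiv_frac_rel, of "(a, s)" "(b, t)"]
  by (simp add: frac_def frac_rel_iff)

lemma frac_eqI:
  assumes "a \<in> carrier R" "b \<in> carrier R" "s \<in> S" "t \<in> S" "a \<otimes> t = b \<otimes> s"
  shows "frac R S a s = frac R S b t"
  using assms one_in_S by (auto simp: frac_eq_iff)

lemma frac_cases:
  assumes "X \<in> carrier (localization R S)"
  obtains a s where "a \<in> carrier R" "s \<in> S" "X = frac R S a s"
  using assms by (auto simp: localization_def frac_def elim!: quotientE)

lemma frac_closed [simp]:
  "\<lbrakk>a \<in> carrier R; s \<in> S\<rbrakk> \<Longrightarrow> frac R S a s \<in> carrier (localization R S)"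
  by (auto simp: localization_def frac_def intro!: quotientI)

text \<open>The operations of \<open>localization\<close> are unions over all representatives.
  Independence of the choice makes all members of the union equal, and reflexivity of
  \<open>frac_rel\<close> makes the union nonempty.\<close>

lemma UN_frac_eq:
  assumes "a \<in> carrier R" "s \<in> S" "b \<in> carrier R" "t \<in> S"
    and "\<And>a' s' b' t'. \<lbrakk>((a, s), (a', s')) \<in> frac_rel R S; ((b, t), (b', t')) \<in> frac_rel R S\<rbrakk> \<Longrightarrow>
      F a' s' b' t' = Z"
  shows "(\<Union>(a', s')\<in>frac R S a s. \<Union>(b', t')\<in>frac R S b t. F a' s' b' t') = Z"
proof -
  have "(a, s) \<in> frac R S a s" "(b, t) \<in> frac R S b t"
    using assms(1-4) equiv_class_self[OF equiv_frac_rel] by (auto simp: frac_def)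
  moreover have "F a' s' b' t' = Z" if "(a', s') \<in> frac R S a s" "(b', t') \<in> frac R S b t" for a' s' b' t'
    using that assms(5) by (auto simp: frac_def)
  ultimately show ?thesis by fast
qed

lemma frac_mult:
  assumes "a \<in> carrier R" "b \<in> carrier R" "s \<in> S" "t \<in> S"
  shows "frac R S a s \<otimes>\<^bsub>localization R S\<^esub> frac R S b t = frac R S (a \<otimes> b) (s \<otimes> t)"
proof -
  have "frac R S (a' \<otimes> b') (s' \<otimes> t') = frac R S (a \<otimes> b) (s \<otimes> t)"
    if rel: "((a, s), (a', s')) \<in> frac_rel R S" "((b, t), (b', t')) \<in> frac_rel R S" for a' s' b' t'
  proof -
    obtain w v where c: "a' \<in> carrier R" "b' \<in> carrier R" "s' \<in> S" "t' \<in> S" "w \<in> S" "v \<in> S"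
      and w: "w \<otimes> (a \<otimes> s') = w \<otimes> (a' \<otimes> s)" and v: "v \<otimes> (b \<otimes> t') = v \<otimes> (b' \<otimes> t)"
      using rel by (auto simp: frac_rel_iff)
    have "(w \<otimes> v) \<otimes> ((a' \<otimes> b') \<otimes> (s \<otimes> t)) = (w \<otimes> (a' \<otimes> s)) \<otimes> (v \<otimes> (b' \<otimes> t))"
      using c assms by (simp add: m_ac)
    also have "\<dots> = (w \<otimes> v) \<otimes> ((a \<otimes> b) \<otimes> (s' \<otimes> t'))"
      unfolding w[symmetric] v[symmetric] using c assms by (simp add: m_ac)
    finally show ?thesis using c assms mult_in_S by (subst frac_eq_iff) auto
  qed
  then show ?thesis using UN_frac_eq[OF assms(1,3,2,4), of "\<lambda>a s b t. frac R S (a \<otimes> b) (s \<otimes> t)"]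
    by (simp add: localization_def)
qed

lemma frac_add:
  assumes "a \<in> carrier R" "b \<in> carrier R" "s \<in> S" "t \<in> S"
  shows "frac R S a s \<oplus>\<^bsub>localization R S\<^esub> frac R S b t =
    frac R S ((a \<otimes> t) \<oplus> (b \<otimes> s)) (s \<otimes> t)"
proof -
  have "frac R S ((a' \<otimes> t') \<oplus> (b' \<otimes> s')) (s' \<otimes> t') = frac R S ((a \<otimes> t) \<oplus> (b \<otimes> s)) (s \<otimes> t)"
    if rel: "((a, s), (a', s')) \<in> frac_rel R S" "((b, t), (b', t')) \<in> frac_rel R S" for a' s' b' t'
  proof -
    obtain w v where c: "a' \<in> carrier R" "b' \<in> carrier R" "s' \<in> S" "t' \<in> S" "w \<in> S" "v \<in> S"
      and w: "w \<otimes> (a \<otimes> s') = w \<otimes> (a' \<otimes> s)" and v: "v \<otimes> (b \<otimes> t') = v \<otimes> (b' \<otimes> t)"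
      using rel by (auto simp: frac_rel_iff)
    have "(w \<otimes> v) \<otimes> (((a' \<otimes> t') \<oplus> (b' \<otimes> s')) \<otimes> (s \<otimes> t)) =
        (v \<otimes> t' \<otimes> t) \<otimes> (w \<otimes> (a' \<otimes> s)) \<oplus> (w \<otimes> s' \<otimes> s) \<otimes> (v \<otimes> (b' \<otimes> t))"
      using c assms by (simp add: m_ac l_distr r_distr)
    also have "\<dots> = (w \<otimes> v) \<otimes> (((a \<otimes> t) \<oplus> (b \<otimes> s)) \<otimes> (s' \<otimes> t'))"
      unfolding w[symmetric] v[symmetric] using c assms by (simp add: m_ac l_distr r_distr)
    finally show ?thesis using c assms mult_in_S by (subst frac_eq_iff) auto
  qed
  then show ?thesis
    using UN_frac_eq[OF assms(1,3,2,4), of "\<lambda>a s b t. frac R S ((a \<otimes> t) \<oplus> (b \<otimes> s)) (s \<otimes> t)"]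
    by (simp add: localization_def)
qed

lemma one_localization: "\<one>\<^bsub>localization R S\<^esub> = frac R S \<one> \<one>"
  and zero_localization: "\<zero>\<^bsub>localization R S\<^esub> = frac R S \<zero> \<one>"
  by (simp_all add: localization_def)

lemmas localization_simps = frac_mult frac_add one_localization zero_localization

lemma cring_localization: "cring (localization R S)"
proof (rule cringI)
  show "abelian_group (localization R S)"
  proof (rule abelian_groupI)
    fix X assume "X \<in> carrier (localization R S)"
    then obtain a s where X: "a \<in> carrier R" "s \<in> S" "X = frac R S a s" by (rule frac_cases)
    then show "\<zero>\<^bsub>localization R S\<^esub> \<oplus>\<^bsub>localization R S\<^esub> X = X"
      using one_in_S by (simp add: localization_simps)
    have "frac R S (\<ominus> a) s \<oplus>\<^bsub>localization R S\<^esub> X = \<zero>\<^bsub>localization R S\<^esub>"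
      using X one_in_S mult_in_S 
      by (simp add: localization_simps l_minus l_neg, intro frac_eqI) simp_all
    then show "\<exists>Y\<in>carrier (localization R S). Y \<oplus>\<^bsub>localization R S\<^esub> X = \<zero>\<^bsub>localization R S\<^esub>"
      using X by (intro bexI[of _ "frac R S (\<ominus> a) s"]) auto
  next
    fix X Y Z
    assume "X \<in> carrier (localization R S)" "Y \<in> carrier (localization R S)"
      "Z \<in> carrier (localization R S)"
    then show "X \<oplus>\<^bsub>localization R S\<^esub> Y \<oplus>\<^bsub>localization R S\<^esub> Z =
        X \<oplus>\<^bsub>localization R S\<^esub> (Y \<oplus>\<^bsub>localization R S\<^esub> Z)"
      by (elim frac_cases) (simp add: localization_simps mult_in_S l_distr r_distr m_ac a_ac)
  next
    fix X Y
    assume "X \<in> carrier (localization R S)" "Y \<in> carrier (localization R S)"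
    then show "X \<oplus>\<^bsub>localization R S\<^esub> Y = Y \<oplus>\<^bsub>localization R S\<^esub> X"
      by (elim frac_cases) (simp add: localization_simps m_ac a_ac)
  next
    fix X Y
    assume "X \<in> carrier (localization R S)" "Y \<in> carrier (localization R S)"
    then show "X \<oplus>\<^bsub>localization R S\<^esub> Y \<in> carrier (localization R S)"
      by (elim frac_cases) (simp add: localization_simps mult_in_S)
  qed (simp add: zero_localization one_in_S)
  show "comm_monoid (localization R S)"
  proof (rule comm_monoidI)
    fix X Y
    assume "X \<in> carrier (localization R S)" "Y \<in> carrier (localization R S)"
    then show "X \<otimes>\<^bsub>localization R S\<^esub> Y = Y \<otimes>\<^bsub>localization R S\<^esub> X"
      by (elim frac_cases) (simp add: localization_simps m_ac)
  next
    fix X Y Z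
    assume "X \<in> carrier (localization R S)" "Y \<in> carrier (localization R S)"
      "Z \<in> carrier (localization R S)"
    then show "X \<otimes>\<^bsub>localization R S\<^esub> Y \<otimes>\<^bsub>localization R S\<^esub> Z =
        X \<otimes>\<^bsub>localization R S\<^esub> (Y \<otimes>\<^bsub>localization R S\<^esub> Z)"
      by (elim frac_cases) (simp add: localization_simps mult_in_S m_ac)
  next
    fix X Y
    assume "X \<in> carrier (localization R S)" "Y \<in> carrier (localization R S)"
    then show "X \<otimes>\<^bsub>localization R S\<^esub> Y \<in> carrier (localization R S)"
      by (elim frac_cases) (simp add: localization_simps mult_in_S)
  next
    fix X
    assume "X \<in> carrier (localization R S)"
    then show "\<one>\<^bsub>localization R S\<^esub> \<otimes>\<^bsub>localization R S\<^esub> X = X"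
      by (elim frac_cases) (simp add: localization_simps one_in_S)
  qed (simp add: one_localization one_in_S)
next
  fix X Y Z
  assume "X \<in> carrier (localization R S)" "Y \<in> carrier (localization R S)"
    "Z \<in> carrier (localization R S)"
  then show "(X \<oplus>\<^bsub>localization R S\<^esub> Y) \<otimes>\<^bsub>localization R S\<^esub> Z =
      X \<otimes>\<^bsub>localization R S\<^esub> Z \<oplus>\<^bsub>localization R S\<^esub> Y \<otimes>\<^bsub>localization R S\<^esub> Z"
    by (elim frac_cases)
      (simp add: localization_simps mult_in_S, intro frac_eqI;
        simp add: mult_in_S l_distr r_distr m_ac)
qed

lemma localization_map_pow:
  assumes "a \<in> carrier R"
  shows "localization_map R S a [^]\<^bsub>localization R S\<^esub> (n::nat) = localization_map R S (a [^] n)"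
proof -
  interpret L: cring "localization R S" by (rule cring_localization)
  show ?thesis
    using assms one_in_S
    by (induction n) (auto simp: localization_map_def localization_simps)
qed

text \<open>If f/1 = (b/s) y^n, then the denominator s and the multiplier w that witnesses the
  equality of fractions merge into one element of \<open>S\<close>; conversely a/s serves as
  coefficient. From here on only equations in \<open>R\<close> itself occur.\<close>

lemma localization_map_mem_ideal_iff:
  assumes f: "f \<in> carrier R" and y: "y \<in> carrier R"
  shows "localization_map R S f \<in>
      Idl\<^bsub>localization R S\<^esub> {localization_map R S y [^]\<^bsub>localization R S\<^esub> (n::nat)} \<longleftrightarrow>
    (\<exists>s\<in>S. \<exists>a\<in>carrier R. s \<otimes> f = a \<otimes> y [^] n)"
    (is "?l \<longleftrightarrow> ?r")
proof -
  interpret L: cring "localization R S" by (rule cring_localization)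
  let ?y = "localization_map R S (y [^] n)"
  have yn: "y [^] n \<in> carrier R" using y by simp
  have "?l \<longleftrightarrow> (\<exists>X\<in>carrier (localization R S). localization_map R S f = X \<otimes>\<^bsub>localization R S\<^esub> ?y)"
  proof -
    have "Idl\<^bsub>localization R S\<^esub> {localization_map R S y [^]\<^bsub>localization R S\<^esub> n} =
        PIdl\<^bsub>localization R S\<^esub> ?y"
      unfolding localization_map_pow[OF y]
      using yn one_in_S by (intro L.cgenideal_eq_genideal[symmetric]) (simp add: localization_map_def)
    then show ?thesis by (auto simp only: cgenideal_def mem_Collect_eq)
  qed
  also have "\<dots> \<longleftrightarrow> ?r"
  proof
    assume "\<exists>X\<in>carrier (localization R S). localization_map R S f = X \<otimes>\<^bsub>localization R S\<^esub> ?y"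
    then obtain b s where b: "b \<in> carrier R" "s \<in> S"
      and eq: "localization_map R S f = frac R S b s \<otimes>\<^bsub>localization R S\<^esub> ?y"
      by (auto elim!: frac_cases)
    then have "frac R S f \<one> = frac R S (b \<otimes> y [^] n) s"
      using yn one_in_S by (simp add: localization_map_def frac_mult)
    then obtain w where w: "w \<in> S" "w \<otimes> (f \<otimes> s) = w \<otimes> (b \<otimes> y [^] n)"
      using b f yn one_in_S by (auto simp: frac_eq_iff)
    have "(w \<otimes> s) \<otimes> f = (w \<otimes> b) \<otimes> y [^] n"
      using w b f yn by (simp add: m_ac)
    moreover have "w \<otimes> s \<in> S" "w \<otimes> b \<in> carrier R" using w b mult_in_S by simp_all
    ultimately show ?r by blast
  next
    assume ?r
    then obtain s a where sa: "s \<in> S" "a \<in> carrier R" "s \<otimes> f = a \<otimes> y [^] n" by blast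
    then have "localization_map R S f = frac R S a s \<otimes>\<^bsub>localization R S\<^esub> ?y"
      using f yn one_in_S
      by (simp add: localization_map_def frac_mult, intro frac_eqI) (simp_all add: m_comm[of f s])
    then show "\<exists>X\<in>carrier (localization R S). localization_map R S f = X \<otimes>\<^bsub>localization R S\<^esub> ?y"
      using sa by auto
  qed
  finally show ?thesis .
qed

text \<open>The contraction to \<open>R\<close> of the ideal generated by \<open>z\<close> in the
  localization, written without fractions.\<close>

definition saturation :: "'a \<Rightarrow> 'a set" where
  "saturation z = {f \<in> carrier R. \<exists>s\<in>S. \<exists>a\<in>carrier R. s \<otimes> f = a \<otimes> z}"

lemma saturation_ideal:
  assumes z: "z \<in> carrier R"
  shows "ideal (saturation z) R"
proof (rule idealI)
  show "ring R" by (rule ring_axioms)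
  have mult: "x \<otimes> f \<in> saturation z" if f: "f \<in> saturation z" and x: "x \<in> carrier R" for f x
  proof -
    obtain s a where sa: "f \<in> carrier R" "s \<in> S" "a \<in> carrier R" "s \<otimes> f = a \<otimes> z"
      using f by (auto simp: saturation_def)
    have "s \<otimes> (x \<otimes> f) = x \<otimes> (s \<otimes> f)" using sa(1,2) x by (simp add: m_lcomm)
    also have "\<dots> = (x \<otimes> a) \<otimes> z" using sa(3) x z by (simp add: sa(4) m_assoc)
    finally show ?thesis using sa x by (auto simp: saturation_def)
  qed
  then show "x \<otimes> f \<in> saturation z" "f \<otimes> x \<in> saturation z"
    if "f \<in> saturation z" "x \<in> carrier R" for f x
    using that by (auto simp: m_comm[of f x] saturation_def)
  show "subgroup (saturation z) (add_monoid R)"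
  proof (rule add.subgroupI)
    show "saturation z \<subseteq> carrier R" by (auto simp: saturation_def)
    have "\<one> \<otimes> \<zero> = \<zero> \<otimes> z" using z by simp
    then show "saturation z \<noteq> {}" using one_in_S unfolding saturation_def by blast
    fix f assume f: "f \<in> saturation z"
    then have "\<ominus> f = \<ominus> \<one> \<otimes> f" by (simp add: saturation_def l_minus)
    then show "\<ominus> f \<in> saturation z" using mult[OF f, of "\<ominus> \<one>"] by simp
    fix g assume g: "g \<in> saturation z"
    obtain s a where sa: "f \<in> carrier R" "s \<in> S" "a \<in> carrier R" "s \<otimes> f = a \<otimes> z"
      using f by (auto simp: saturation_def)
    obtain t b where tb: "g \<in> carrier R" "t \<in> S" "b \<in> carrier R" "t \<otimes> g = b \<otimes> z"
      using g by (auto simp: saturation_def)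
    have "(s \<otimes> t) \<otimes> (f \<oplus> g) = t \<otimes> (s \<otimes> f) \<oplus> s \<otimes> (t \<otimes> g)"
      using sa(1,2) tb(1,2) by (simp add: r_distr m_ac)
    also have "\<dots> = (t \<otimes> a \<oplus> s \<otimes> b) \<otimes> z"
      using sa tb z by (simp add: l_distr m_assoc)
    finally have "(s \<otimes> t) \<otimes> (f \<oplus> g) = (t \<otimes> a \<oplus> s \<otimes> b) \<otimes> z" .
    moreover have "s \<otimes> t \<in> S" "t \<otimes> a \<oplus> s \<otimes> b \<in> carrier R" "f \<oplus> g \<in> carrier R"
      using sa tb mult_in_S by simp_all
    ultimately show "f \<oplus> g \<in> saturation z"
      unfolding saturation_def by auto
  qed
qed

end


section \<open>The toric algebra of the subdivided cone\<close>

lemma (in cring) ideal_power_principal: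
  assumes y: "y \<in> carrier R"
  shows "ideal_power R (Idl {y}) n = PIdl (y [^] n)"
proof -
  interpret I: comm_monoid "ideals_set R" by (rule ideals_set_is_comm_monoid)
  show ?thesis
  proof (induction n)
    case 0
    have "PIdl \<one> = carrier R" by (force simp: cgenideal_def)
    then show ?case by (simp add: ideal_power_def) (simp add: ideals_set_def)
  next
    case (Suc n)
    have "ideal_power R (Idl {y}) (Suc n) = ideal_prod R (PIdl (y [^] n)) (PIdl y)"
      using Suc y by (simp add: ideal_power_def cgenideal_eq_genideal) (simp add: ideals_set_def)
    also have "\<dots> = Idl (PIdl (y [^] n) <#> PIdl y)"
      using y by (intro ideal_prod_eq_genideal cgenideal_ideal) auto
    also have "\<dots> = PIdl (y [^] Suc n)"
      using y cgenideal_ideal[of "y [^] Suc n"]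
      by (simp add: cgenideal_prod genideal_minimal genideal_self subset_antisym
          cgenideal_minimal cgenideal_self)
        (metis (no_types, lifting) additive_subgroup.a_subset genideal_minimal genideal_self
          ideal.axioms(1) order_refl subset_antisym)
    finally show ?case .
  qed
qed

text \<open>The elements \<open>j\<close> with \<open>a \<otimes> j\<close> in \<open>L\<close> form
  the colon ideal of \<open>L\<close> by \<open>a\<close>. It contains \<open>y\<close> and
  \<open>z\<close>, hence all of \<open>Idl {y, z}\<close>.\<close>

lemma (in cring) ideal_prod_principal_subset:
  assumes L: "ideal L R" and yz: "{y, z} \<subseteq> carrier R" and a: "a \<in> carrier R"
    and mem: "a \<otimes> y \<in> L" "a \<otimes> z \<in> L"
  shows "ideal_prod R (PIdl a) (Idl {y, z}) \<subseteq> L"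
proof -
  interpret L: ideal L R by (rule L)
  have "ideal {j \<in> carrier R. a \<otimes> j \<in> L} R"
  proof (rule idealI)
    show "ring R" by (rule ring_axioms)
    show "subgroup {j \<in> carrier R. a \<otimes> j \<in> L} (add_monoid R)"
    proof (rule add.subgroupI)
      have "\<zero> \<in> {j \<in> carrier R. a \<otimes> j \<in> L}" using a by simp
      then show "{j \<in> carrier R. a \<otimes> j \<in> L} \<noteq> {}" by blast
    qed (use a in \<open>auto simp: r_distr r_minus\<close>)
  next
    fix j x assume j: "j \<in> {j \<in> carrier R. a \<otimes> j \<in> L}" and x: "x \<in> carrier R"
    have "a \<otimes> (x \<otimes> j) = x \<otimes> (a \<otimes> j)" "a \<otimes> (j \<otimes> x) = x \<otimes> (a \<otimes> j)"
      using j x a by (auto simp: m_ac)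
    then show "x \<otimes> j \<in> {j \<in> carrier R. a \<otimes> j \<in> L}" "j \<otimes> x \<in> {j \<in> carrier R. a \<otimes> j \<in> L}"
      using j x L.I_l_closed by auto
  qed
  then have gen: "Idl {y, z} \<subseteq> {j \<in> carrier R. a \<otimes> j \<in> L}"
    using yz mem by (intro genideal_minimal) auto
  show ?thesis
  proof
    fix w assume "w \<in> ideal_prod R (PIdl a) (Idl {y, z})"
    then show "w \<in> L"
    proof (induction rule: ideal_prod.induct)
      case (prod i j)
      then obtain x where "x \<in> carrier R" "i = x \<otimes> a" by (auto simp: cgenideal_def)
      moreover have "j \<in> carrier R" "a \<otimes> j \<in> L" using prod gen by auto
      ultimately show ?case using a L.I_l_closed by (simp add: m_assoc)
    next
      case (sum u v)
      then show ?case by simp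
    qed
  qed
qed

lemma (in cring) ideal_prod_principal_gens:
  assumes yz: "{y, z} \<subseteq> carrier R" and a: "a \<in> carrier R"
  shows "ideal (ideal_prod R (PIdl a) (Idl {y, z})) R"
    "a \<otimes> y \<in> ideal_prod R (PIdl a) (Idl {y, z})" "a \<otimes> z \<in> ideal_prod R (PIdl a) (Idl {y, z})"
  using yz a genideal_self[OF yz]
  by (auto intro: ideal_prod_is_ideal cgenideal_ideal genideal_ideal ideal_prod.prod cgenideal_self)


section \<open>Additive maps on finitely supported functions, and subrings\<close>

definition pm_extend :: "('a \<Rightarrow> 'b::zero \<Rightarrow> 'c::comm_monoid_add) \<Rightarrow> ('a \<Rightarrow>\<^sub>0 'b) \<Rightarrow> 'c" where
  "pm_extend F p = (\<Sum>k\<in>Poly_Mapping.keys p. F k (Poly_Mapping.lookup p k))"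

lemma pm_extend_superset:
  assumes "\<And>k. F k 0 = 0" "finite B" "Poly_Mapping.keys p \<subseteq> B"
  shows "pm_extend F p = (\<Sum>k\<in>B. F k (Poly_Mapping.lookup p k))"
  unfolding pm_extend_def using assms
  by (intro sum.mono_neutral_left) (auto simp: in_keys_iff)

lemma pm_extend_single:
  assumes "\<And>k. F k 0 = 0"
  shows "pm_extend F (Poly_Mapping.single k c) = F k c"
  using pm_extend_superset[of F "{k}", OF assms] by simp

lemma pm_extend_zero [simp]: "pm_extend F 0 = 0"
  by (simp add: pm_extend_def)

lemma pm_extend_add:
  assumes "\<And>k. F k 0 = 0" "\<And>k a b. F k (a + b) = F k a + F k b"
  shows "pm_extend F (p + q) = pm_extend F p + pm_extend F q"
proof -
  let ?B = "Poly_Mapping.keys p \<union> Poly_Mapping.keys q"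
  have "pm_extend F (p + q) = (\<Sum>k\<in>?B. F k (Poly_Mapping.lookup (p + q) k))"
    "pm_extend F p = (\<Sum>k\<in>?B. F k (Poly_Mapping.lookup p k))"
    "pm_extend F q = (\<Sum>k\<in>?B. F k (Poly_Mapping.lookup q k))"
    using Poly_Mapping.keys_add[of p q] by (intro pm_extend_superset assms(1); auto)+
  then show ?thesis by (simp add: lookup_add assms(2) sum.distrib)
qed

lemma pm_extend_sum:
  assumes "\<And>k. F k 0 = 0" "\<And>k a b. F k (a + b) = F k a + F k b"
  shows "pm_extend F (\<Sum>x\<in>X. p x) = (\<Sum>x\<in>X. pm_extend F (p x))"
  by (induction X rule: infinite_finite_induct) (simp_all add: pm_extend_add assms)

lemma sum_single_lookup: "(\<Sum>k\<in>Poly_Mapping.keys p. Poly_Mapping.single k (Poly_Mapping.lookup p k)) = p"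
  by (rule poly_mapping_eqI)
    (auto simp: lookup_sum lookup_single when_def sum.delta in_keys_iff)

lemma pm_extend_mult:
  fixes p q :: "'a::comm_monoid_add \<Rightarrow>\<^sub>0 'b::comm_ring_1" and F :: "'a \<Rightarrow> 'b \<Rightarrow> 'c::comm_ring_1"
  assumes "\<And>k. H k 0 = 0" "\<And>k a b. H k (a + b) = H k a + H k b"
    and "\<And>k l a b. H (k + l) (a * b) = F k a * G l b"
  shows "pm_extend H (p * q) = pm_extend F p * pm_extend G q"
proof -
  have "p * q = (\<Sum>k\<in>Poly_Mapping.keys p. Poly_Mapping.single k (Poly_Mapping.lookup p k)) *
    (\<Sum>l\<in>Poly_Mapping.keys q. Poly_Mapping.single l (Poly_Mapping.lookup q l))"
    by (simp add: sum_single_lookup)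
  also have "\<dots> = (\<Sum>k\<in>Poly_Mapping.keys p. \<Sum>l\<in>Poly_Mapping.keys q.
      Poly_Mapping.single (k + l) (Poly_Mapping.lookup p k * Poly_Mapping.lookup q l))"
    by (simp add: sum_product mult_single)
  finally show ?thesis
    by (simp add: pm_extend_sum pm_extend_single assms) (simp add: pm_extend_def sum_product)
qed

text \<open>Multiplication by a monomial translates the exponents, and cancellation in the exponent
  monoid excludes collisions.\<close>

lemma lookup_single_mult:
  fixes q :: "'a::cancel_comm_monoid_add \<Rightarrow>\<^sub>0 'b::comm_ring_1"
  shows "Poly_Mapping.lookup (Poly_Mapping.single k 1 * q) (k + l) = Poly_Mapping.lookup q l"
proof -
  have "Poly_Mapping.single k 1 * q =
      (\<Sum>m\<in>Poly_Mapping.keys q. Poly_Mapping.single (k + m) (Poly_Mapping.lookup q m))"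
    by (subst sum_single_lookup[of q, symmetric]) (simp add: sum_distrib_left mult_single)
  then show ?thesis
    by (auto simp: lookup_sum lookup_single when_def sum.delta in_keys_iff)
qed

lemma Sum_any_closed:
  assumes "0 \<in> B" "\<And>a b. \<lbrakk>a \<in> B; b \<in> B\<rbrakk> \<Longrightarrow> a + b \<in> B" "\<And>x. h x \<in> B"
  shows "Sum_any h \<in> B"
proof -
  have "sum h X \<in> B" for X
    by (induction X rule: infinite_finite_induct) (auto simp: assms)
  then show ?thesis by (simp add: Sum_any.expand_set)
qed

lemma subring_record_simps [simp]:
  "carrier (subring_record S) = S" "mult (subring_record S) = (*)" "add (subring_record S) = (+)"
  "one (subring_record S) = 1" "zero (subring_record S) = 0"
  by (simp_all add: subring_record_def)

lemma cring_subring_record: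
  assumes "0 \<in> S" "1 \<in> S" "\<And>a b. \<lbrakk>a \<in> S; b \<in> S\<rbrakk> \<Longrightarrow> a + b \<in> S" "\<And>a. a \<in> S \<Longrightarrow> - a \<in> S"
    "\<And>a b. \<lbrakk>a \<in> S; b \<in> S\<rbrakk> \<Longrightarrow> a * b \<in> S"
  shows "cring (subring_record S)"
proof (rule cringI)
  show "abelian_group (subring_record S)"
    using assms by (intro abelian_groupI) (auto simp: algebra_simps intro: bexI[of _ "- _"])
  show "comm_monoid (subring_record S)"
    using assms by (intro comm_monoidI) (auto simp: algebra_simps)
qed (simp add: algebra_simps)

section \<open>Pairings, the dual monoid and monomials\<close>

definition edge_vec :: "'e \<Rightarrow> int \<Rightarrow> 'e \<Rightarrow> int" where
  "edge_vec e\<^sub>0 i = (\<lambda>e. if e = e\<^sub>0 then i else 0)"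

lemma edge_vec_simps [simp]:
  "edge_vec e\<^sub>0 0 = 0" "edge_vec e\<^sub>0 i + edge_vec e\<^sub>0 j = edge_vec e\<^sub>0 (i + j)"
  by (auto simp: edge_vec_def)

lemma coordinate_eq: "coordinate e\<^sub>0 = edge_vec e\<^sub>0 1"
  by (simp add: coordinate_def edge_vec_def)

lemma pairing_add: "pairing Ed (u + v) x = pairing Ed u x + pairing Ed v x"
  by (simp add: pairing_def sum.distrib algebra_simps)

lemma pairing_zero [simp]: "pairing Ed 0 x = 0"
  by (simp add: pairing_def)

lemma pairing_edge_vec:
  assumes "finite Ed" "e\<^sub>0 \<in> Ed"
  shows "pairing Ed (edge_vec e\<^sub>0 i) x = of_int i * x e\<^sub>0"
proof -
  have "pairing Ed (edge_vec e\<^sub>0 i) x = (\<Sum>e\<in>Ed. if e = e\<^sub>0 then of_int i * x e else 0)"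
    unfolding pairing_def edge_vec_def by (intro sum.cong) auto
  then show ?thesis using assms by simp
qed

lemma pairing_of_int: "pairing Ed u (\<lambda>e. of_int (r e)) = of_int (pairing Ed u r)"
  by (simp add: pairing_def)

lemma pairing_scale: "pairing Ed u (\<lambda>e. c * x e) = c * pairing Ed u x"
  by (simp add: pairing_def sum_distrib_left mult.left_commute)

lemma dual_monoid_zero: "0 \<in> dual_monoid Ed K"
  by (simp add: dual_monoid_def)

lemma dual_monoid_add:
  "\<lbrakk>u \<in> dual_monoid Ed K; v \<in> dual_monoid Ed K\<rbrakk> \<Longrightarrow> u + v \<in> dual_monoid Ed K"
  by (auto simp: dual_monoid_def pairing_add)

lemma pairing_ray_nonneg:
  assumes "u \<in> dual_monoid Ed K" "ray r \<subseteq> K"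
  shows "pairing Ed u r \<ge> 0"
proof -
  have "(\<lambda>e. of_int (r e)) \<in> ray r" by (auto simp: ray_def intro: exI[of _ 1])
  then have "pairing Ed u (\<lambda>e. real_of_int (r e)) \<ge> 0"
    using assms by (auto simp: dual_monoid_def)
  then show ?thesis by (simp add: pairing_of_int)
qed

text \<open>The monomial c \<chi>^u x^i y^j with \<open>c\<close> in the base field.\<close>

definition xmon :: "'k \<Rightarrow> ('e \<Rightarrow> int) \<Rightarrow> nat \<Rightarrow> nat \<Rightarrow> ('e, 'k::field) poly_xy" where
  "xmon c u i j = Poly_Mapping.single (i, j) (Poly_Mapping.single u c)"

lemma xmon_mult: "xmon c u i j * xmon d v k l = xmon (c * d) (u + v) (i + k) (j + l)"
  by (simp add: xmon_def mult_single)

lemma xmon_one: "xmon 1 0 0 0 = 1"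
  by (simp add: xmon_def flip: zero_prod_def)

lemma xmon_zero: "xmon 0 u i j = 0"
  by (simp add: xmon_def)

lemma xmon_add: "xmon (c + d) u i j = xmon c u i j + xmon d u i j"
  by (simp add: xmon_def single_add)

lemma poly_x_eq: "poly_x = xmon 1 0 1 0"
  and poly_y_eq: "poly_y = xmon 1 0 0 1"
  and poly_const_char_eq: "poly_const (char_alg u) = xmon 1 u 0 0"
  by (simp_all add: poly_x_def poly_y_def poly_const_def char_alg_def xmon_def)

text \<open>
  The map to the Laurent algebra \<open>k[M][y, y\<inverse>]\<close> that sends \<open>x\<close> to \<open>\<chi>\<^sup>e y\<inverse>\<close>, where \<open>e\<close> is the
  coordinate functional of \<open>e\<^sub>0\<close>; it identifies the characters of \<open>\<tau>\<close> with pairs \<open>(v, j)\<close>.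
\<close>

definition laurent_term :: "'e \<Rightarrow> nat \<times> nat \<Rightarrow> ('e \<Rightarrow> int) \<Rightarrow> 'k::field \<Rightarrow>
    (('e \<Rightarrow> int) \<times> int) \<Rightarrow>\<^sub>0 'k" where
  "laurent_term e\<^sub>0 m u c =
     Poly_Mapping.single (u + edge_vec e\<^sub>0 (int (fst m)), int (snd m) - int (fst m)) c"

definition laurent :: "'e \<Rightarrow> ('e, 'k::field) poly_xy \<Rightarrow> (('e \<Rightarrow> int) \<times> int) \<Rightarrow>\<^sub>0 'k" where
  "laurent e\<^sub>0 = pm_extend (\<lambda>m. pm_extend (laurent_term e\<^sub>0 m))"

lemma laurent_term_simps [simp]:
  "laurent_term e\<^sub>0 m u 0 = 0"
  "laurent_term e\<^sub>0 m u (c + d) = laurent_term e\<^sub>0 m u c + laurent_term e\<^sub>0 m u d"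
  by (simp_all add: laurent_term_def single_add)

lemma laurent_term_mult:
  "laurent_term e\<^sub>0 (m + m') (u + v) (c * d) = laurent_term e\<^sub>0 m u c * laurent_term e\<^sub>0 m' v d"
proof -
  have 1: "(u + v) + edge_vec e\<^sub>0 (int (fst (m + m'))) =
      (u + edge_vec e\<^sub>0 (int (fst m))) + (v + edge_vec e\<^sub>0 (int (fst m')))"
    by (simp add: fun_eq_iff edge_vec_def)
  have 2: "int (snd (m + m')) - int (fst (m + m')) =
      (int (snd m) - int (fst m)) + (int (snd m') - int (fst m'))"
    by simp
  show ?thesis by (simp only: laurent_term_def mult_single 1 2 add_Pair)
qed

lemma laurent_zero [simp]: "laurent e\<^sub>0 0 = 0"
  by (simp add: laurent_def)

lemma laurent_add: "laurent e\<^sub>0 (P + Q) = laurent e\<^sub>0 P + laurent e\<^sub>0 Q"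
  unfolding laurent_def by (intro pm_extend_add) (simp_all add: pm_extend_add)

lemma laurent_diff: "laurent e\<^sub>0 (P - Q) = laurent e\<^sub>0 P - laurent e\<^sub>0 Q"
  using laurent_add[of e\<^sub>0 "P - Q" Q] by (simp add: algebra_simps)

lemma laurent_sum: "laurent e\<^sub>0 (\<Sum>x\<in>X. P x) = (\<Sum>x\<in>X. laurent e\<^sub>0 (P x))"
  by (induction X rule: infinite_finite_induct) (simp_all add: laurent_add)

lemma laurent_mult: "laurent e\<^sub>0 (P * Q) = laurent e\<^sub>0 P * laurent e\<^sub>0 Q"
  unfolding laurent_def
  by (intro pm_extend_mult) (simp_all add: pm_extend_add pm_extend_mult laurent_term_mult)

lemma laurent_xmon:
  "laurent e\<^sub>0 (xmon c u i j) = Poly_Mapping.single (u + edge_vec e\<^sub>0 (int i), int j - int i) c"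
  by (simp add: laurent_def xmon_def pm_extend_single laurent_term_def)

section \<open>The presentation of \<open>A_tau\<close> and its embedding into a Laurent
  algebra\<close>

locale edge_cone =
  fixes Ed :: "'e set" and K :: "('e \<Rightarrow> real) set" and e\<^sub>0 :: 'e
  assumes finite_edges: "finite Ed" and edge: "e\<^sub>0 \<in> Ed"
    and cone_nonneg: "v \<in> K \<Longrightarrow> v e\<^sub>0 \<ge> 0"
begin

abbreviation M where "M \<equiv> dual_monoid Ed K"

abbreviation ev where "ev \<equiv> edge_vec e\<^sub>0"

abbreviation R where "R \<equiv> A_cone_xy Ed K"

abbreviation A where "A \<equiv> A_tau Ed K e\<^sub>0"

abbreviation cl where "cl \<equiv> tau_class Ed K e\<^sub>0"

lemma ev_mem: "i \<ge> 0 \<Longrightarrow> ev i \<in> M"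
  using edge cone_nonneg
  by (auto simp: dual_monoid_def pairing_edge_vec[OF finite_edges edge]) (auto simp: edge_vec_def)

lemma carrier_R: "P \<in> carrier R \<longleftrightarrow> (\<forall>m. Poly_Mapping.keys (Poly_Mapping.lookup P m) \<subseteq> M)"
  by (simp add: A_cone_xy_def A_cone_def)

lemma keys_lookup_R: "P \<in> carrier R \<Longrightarrow> Poly_Mapping.keys (Poly_Mapping.lookup P m) \<subseteq> M"
  by (simp only: carrier_R)

lemma R_simps [simp]:
  "mult R = (*)" "add R = (+)" "one R = 1" "zero R = 0"
  by (simp_all add: A_cone_xy_def)

lemma R_zero: "0 \<in> carrier R"
  by (simp add: carrier_R)

lemma R_add: "\<lbrakk>P \<in> carrier R; Q \<in> carrier R\<rbrakk> \<Longrightarrow> P + Q \<in> carrier R"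
  unfolding carrier_R lookup_add using Poly_Mapping.keys_add by fast

lemma R_uminus: "P \<in> carrier R \<Longrightarrow> - P \<in> carrier R"
  by (simp add: carrier_R)

lemma R_minus: "\<lbrakk>P \<in> carrier R; Q \<in> carrier R\<rbrakk> \<Longrightarrow> P - Q \<in> carrier R"
  using R_add[OF _ R_uminus, of P Q] by simp

lemma R_mult:
  fixes P Q :: "('e, 'k::field) poly_xy"
  assumes P: "P \<in> carrier R" and Q: "Q \<in> carrier R"
  shows "P * Q \<in> carrier R"
proof -
  let ?B = "{f. Poly_Mapping.keys f \<subseteq> M}"
  have add: "f + g \<in> ?B" if "f \<in> ?B" "g \<in> ?B" for f g :: "('e, 'k) group_algebra"
    using that Poly_Mapping.keys_add[of f g] by blast
  have mult: "f * g \<in> ?B" if "f \<in> ?B" "g \<in> ?B" for f g :: "('e, 'k) group_algebra"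
    using that Poly_Mapping.keys_mult[of f g] dual_monoid_add[of _ Ed K] by blast
  have "Poly_Mapping.lookup (P * Q) m \<in> ?B" for m
    unfolding lookup_mult
  proof (rule Sum_any_closed[OF _ add])
    fix l
    have "(\<Sum>q. Poly_Mapping.lookup Q q when m = l + q) \<in> ?B"
      by (rule Sum_any_closed[OF _ add]) (use keys_lookup_R[OF Q] in \<open>auto simp: when_def\<close>)
    then show "Poly_Mapping.lookup P l * (\<Sum>q. Poly_Mapping.lookup Q q when m = l + q) \<in> ?B"
      using keys_lookup_R[OF P] by (intro mult) simp_all
  qed auto
  then show ?thesis by (simp add: carrier_R)
qed

lemma xmon_mem: "u \<in> M \<Longrightarrow> xmon c u i j \<in> carrier R"
  by (auto simp: carrier_R xmon_def lookup_single when_def)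

lemma R_one: "1 \<in> carrier R"
  using xmon_mem[OF dual_monoid_zero, of 1 0 0] by (simp add: xmon_one)

lemma R_sum: "(\<And>x. x \<in> X \<Longrightarrow> P x \<in> carrier R) \<Longrightarrow> (\<Sum>x\<in>X. P x) \<in> carrier R"
  by (induction X rule: infinite_finite_induct) (auto simp: R_add R_zero)

lemmas R_closed = R_zero R_one R_add R_uminus R_minus R_mult xmon_mem dual_monoid_zero ev_mem
  dual_monoid_add

lemma cring_R: "cring (R :: ('e, 'k::field) poly_xy ring)"
proof -
  have "cring (subring_record (carrier (R :: ('e, 'k) poly_xy ring)))"
    by (rule cring_subring_record) (auto intro: R_closed)
  then show ?thesis by (simp add: A_cone_xy_def)
qed

text \<open>Expanding in x and y and each coefficient in characters writes an element of
  \<open>R\<close> as a finite sum of monomials with exponents in \<open>M\<close>, so additive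
  statements need a proof for monomials only.\<close>

lemma carrier_induct [consumes 1, case_names zero add xmon]:
  fixes P :: "('e, 'k::field) poly_xy"
  assumes P: "P \<in> carrier R" and zero: "Z 0"
    and add: "\<And>P Q. \<lbrakk>P \<in> carrier R; Q \<in> carrier R; Z P; Z Q\<rbrakk> \<Longrightarrow> Z (P + Q)"
    and xmon: "\<And>c u i j. u \<in> M \<Longrightarrow> Z (xmon c u i j)"
  shows "Z P"
proof -
  have sum: "(\<Sum>x\<in>X. Q x) \<in> carrier R \<and> Z (\<Sum>x\<in>X. Q x)"
    if "\<And>x. x \<in> X \<Longrightarrow> Q x \<in> carrier R \<and> Z (Q x)" for X and Q :: "'c \<Rightarrow> ('e, 'k) poly_xy"
    using that by (induction X rule: infinite_finite_induct) (auto simp: R_zero R_add zero add)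
  have "Poly_Mapping.single m (Poly_Mapping.lookup P m) \<in> carrier R \<and>
      Z (Poly_Mapping.single m (Poly_Mapping.lookup P m))" for m
  proof -
    let ?f = "Poly_Mapping.lookup P m"
    have single_sum: "Poly_Mapping.single m (\<Sum>x\<in>X. g x) = (\<Sum>x\<in>X. Poly_Mapping.single m (g x))"
      for X and g :: "'c \<Rightarrow> ('e, 'k) group_algebra"
      by (induction X rule: infinite_finite_induct) (auto simp: single_add)
    have "Poly_Mapping.single m ?f =
        (\<Sum>u\<in>Poly_Mapping.keys ?f. xmon (Poly_Mapping.lookup ?f u) u (fst m) (snd m))"
      by (subst sum_single_lookup[of ?f, symmetric]) (simp add: single_sum xmon_def)
    moreover have "xmon c u i j \<in> carrier R \<and> Z (xmon c u i j)"
      if "u \<in> Poly_Mapping.keys ?f" for c u i j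
      using keys_lookup_R[OF P, of m] that xmon xmon_mem by blast
    ultimately show ?thesis
      using sum[of "Poly_Mapping.keys ?f" "\<lambda>u. xmon (Poly_Mapping.lookup ?f u) u (fst m) (snd m)"]
      by simp
  qed
  then show ?thesis using sum[of "Poly_Mapping.keys P"] sum_single_lookup[of P] by metis
qed

definition rel where "rel = xmon 1 0 1 1 - xmon 1 (ev 1) 0 0"

lemma rel_mem: "rel \<in> carrier R"
  unfolding rel_def by (intro R_closed) auto

lemma tau_relations_eq:
  "tau_relations Ed K e\<^sub>0 = {h * rel | h :: ('e, 'k::field) poly_xy. h \<in> carrier R}"
proof -
  interpret cring "R :: ('e, 'k) poly_xy ring" by (rule cring_R)
  show ?thesis
    using cgenideal_eq_genideal[OF rel_mem]
    by (simp add: tau_relations_def rel_def poly_x_eq poly_y_eq poly_const_char_eq coordinate_eq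
        xmon_mult cgenideal_def)
qed

lemma tau_relations_ideal: "ideal (tau_relations Ed K e\<^sub>0) (R :: ('e, 'k::field) poly_xy ring)"
proof -
  interpret cring "R :: ('e, 'k) poly_xy ring" by (rule cring_R)
  show ?thesis using cgenideal_ideal[OF rel_mem] by (simp add: tau_relations_eq cgenideal_def)
qed

lemma tau_relations_add:
  "\<lbrakk>P \<in> tau_relations Ed K e\<^sub>0; Q \<in> tau_relations Ed K e\<^sub>0\<rbrakk> \<Longrightarrow> P + Q \<in> tau_relations Ed K e\<^sub>0"
  using additive_subgroup.a_closed[OF ideal.axioms(1)[OF tau_relations_ideal]] by simp

lemma tau_relations_zero: "0 \<in> tau_relations Ed K e\<^sub>0"
  using additive_subgroup.zero_closed[OF ideal.axioms(1)[OF tau_relations_ideal]] by simp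

lemma tau_relations_uminus: "P \<in> tau_relations Ed K e\<^sub>0 \<Longrightarrow> - P \<in> tau_relations Ed K e\<^sub>0"
  unfolding tau_relations_eq by (force intro: R_uminus simp flip: mult_minus_left)

lemma cring_A: "cring (A :: ('e, 'k::field) poly_xy set ring)"
  unfolding A_tau_def by (intro ideal.quotient_is_cring tau_relations_ideal cring_R)

lemma cl_hom: "cl \<in> ring_hom (R :: ('e, 'k::field) poly_xy ring) A"
  unfolding A_tau_def tau_class_def[abs_def] by (rule ideal.rcos_ring_hom[OF tau_relations_ideal])

lemma cl_closed: "P \<in> carrier R \<Longrightarrow> cl P \<in> carrier A"
  by (rule ring_hom_closed[OF cl_hom])

lemma cl_simps:
  assumes "P \<in> carrier R" "Q \<in> carrier R"
  shows "cl P \<otimes>\<^bsub>A\<^esub> cl Q = cl (P * Q)" "cl P \<oplus>\<^bsub>A\<^esub> cl Q = cl (P + Q)"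
  using ring_hom_mult[OF cl_hom assms] ring_hom_add[OF cl_hom assms] by simp_all

lemma cl_one: "\<one>\<^bsub>A\<^esub> = cl 1"
  by (simp flip: ring_hom_one[OF cl_hom])

lemma cl_zero: "\<zero>\<^bsub>A\<^esub> = (cl 0 :: ('e, 'k::field) poly_xy set)"
  using ring_hom_zero[OF cl_hom] cring.axioms(1)[OF cring_R] cring.axioms(1)[OF cring_A] by force

lemma cl_surj:
  assumes "f \<in> carrier A"
  obtains P where "P \<in> carrier R" "f = cl P"
  using assms by (auto simp: A_tau_def FactRing_def A_RCOSETS_def' tau_class_def)

lemma cl_eq_iff:
  fixes P Q :: "('e, 'k::field) poly_xy"
  assumes "P \<in> carrier R" "Q \<in> carrier R"
  shows "cl P = cl Q \<longleftrightarrow> P - Q \<in> tau_relations Ed K e\<^sub>0"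
proof -
  interpret cring "R :: ('e, 'k) poly_xy ring" by (rule cring_R)
  have "\<ominus>\<^bsub>R\<^esub> Q = - Q" using assms(2) R_uminus by (intro minus_equality) auto
  then show ?thesis
    using quotient_eq_iff_same_a_r_cos[OF tau_relations_ideal assms]
    by (simp add: tau_class_def a_minus_def)
qed

lemma laurent_rel: "laurent e\<^sub>0 rel = 0"
  by (simp add: rel_def laurent_diff laurent_xmon)

text \<open>Each factor x y is traded for \<chi>^e, at the cost of a multiple of \<open>rel\<close>.
  The exponent stays in \<open>M\<close> because \<open>M\<close> contains e.\<close>

lemma reduce_monomial:
  assumes "u \<in> M"
  shows "xmon c u (a + n) (b + n) - xmon c (u + ev (int n)) a b \<in> tau_relations Ed K e\<^sub>0"
  using assms
proof (induction n arbitrary: u)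
  case 0
  then show ?case by (simp add: tau_relations_zero)
next
  case (Suc n)
  have "xmon c u (a + Suc n) (b + Suc n) - xmon c (u + ev 1) (a + n) (b + n) =
      xmon c u (a + n) (b + n) * rel"
    by (simp add: rel_def right_diff_distrib xmon_mult)
  then have "xmon c u (a + Suc n) (b + Suc n) - xmon c (u + ev 1) (a + n) (b + n) \<in> tau_relations Ed K e\<^sub>0"
    using xmon_mem[OF Suc.prems] by (auto simp: tau_relations_eq)
  moreover have "xmon c (u + ev 1) (a + n) (b + n) - xmon c (u + ev 1 + ev (int n)) a b
      \<in> tau_relations Ed K e\<^sub>0"
    using Suc.prems by (intro Suc.IH R_closed) auto
  moreover have "u + ev 1 + ev (int n) = u + ev (int (Suc n))"
    by (simp add: add.assoc)
  ultimately show ?case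
    using tau_relations_add by (metis (no_types, lifting) add_diff_eq diff_add_cancel)
qed

text \<open>The representative of the Laurent term c \<chi>^v y^j, for \<open>k = (v, j)\<close>, in
  which x and y do not occur together: a power of y if j \<ge> 0, and c \<chi>^(v + j e) x^(-j) if j
  < 0.\<close>

definition normal_term where
  "normal_term k c = xmon c (fst k + ev (min (snd k) 0)) (nat (- snd k)) (nat (snd k))"

lemma normal_form_cong:
  assumes "P \<in> carrier R"
  shows "P - pm_extend normal_term (laurent e\<^sub>0 P) \<in> tau_relations Ed K e\<^sub>0"
  using assms
proof (induction rule: carrier_induct)
  case zero
  then show ?case by (simp add: tau_relations_zero)
next
  case (add P Q)
  have "pm_extend normal_term (laurent e\<^sub>0 (P + Q)) =
      pm_extend normal_term (laurent e\<^sub>0 P) + pm_extend normal_term (laurent e\<^sub>0 Q)"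
    unfolding laurent_add by (intro pm_extend_add) (simp_all add: normal_term_def xmon_zero xmon_add)
  then show ?case using tau_relations_add[OF add.IH] by (simp add: algebra_simps)
next
  case (xmon c u i j)
  have "pm_extend normal_term (laurent e\<^sub>0 (xmon c u i j)) =
      normal_term (u + ev (int i), int j - int i) c"
    unfolding laurent_xmon by (intro pm_extend_single) (simp add: normal_term_def xmon_zero)
  also have "\<dots> = xmon c (u + ev (int (min i j))) (i - min i j) (j - min i j)"
  proof -
    have "int i + min (int j - int i) 0 = int (min i j)" by auto
    then have "u + ev (int i) + ev (min (int j - int i) 0) = u + ev (int (min i j))"
      by (simp add: add.assoc)
    moreover have "nat (- (int j - int i)) = i - min i j" "nat (int j - int i) = j - min i j" by auto
    ultimately show ?thesis by (simp only: normal_term_def fst_conv snd_conv)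
  qed
  finally show ?case using reduce_monomial[OF xmon, of c "i - min i j" "min i j" "j - min i j"] by simp
qed

text \<open>\<open>laurent\<close> kills the relation, hence is defined on classes. It is injective
  on them because an element is congruent to a normal form computed from its Laurent image
  alone.\<close>

lemma cl_eq_iff_laurent:
  assumes "P \<in> carrier R" "Q \<in> carrier R"
  shows "cl P = cl Q \<longleftrightarrow> laurent e\<^sub>0 P = laurent e\<^sub>0 Q"
proof
  assume "cl P = cl Q"
  then obtain h where "P - Q = h * rel" using assms by (auto simp: cl_eq_iff tau_relations_eq)
  then have "laurent e\<^sub>0 (P - Q) = 0" by (simp add: laurent_mult laurent_rel)
  then show "laurent e\<^sub>0 P = laurent e\<^sub>0 Q" by (simp add: laurent_diff)
next
  assume eq: "laurent e\<^sub>0 P = laurent e\<^sub>0 Q"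
  have "P - Q = (P - pm_extend normal_term (laurent e\<^sub>0 P)) + - (Q - pm_extend normal_term (laurent e\<^sub>0 Q))"
    by (simp add: eq)
  also have "\<dots> \<in> tau_relations Ed K e\<^sub>0"
    using assms by (intro tau_relations_add tau_relations_uminus normal_form_cong)
  finally show "cl P = cl Q" using assms by (simp add: cl_eq_iff)
qed

text \<open>On \<tau> the coordinate b ranges over [0, e], so v + j b is nonnegative there if and
  only if v + min(j, 0) e is nonnegative on \<open>K\<close>. For x^i y^j the multiple of e is i +
  min(j - i, 0) = min(i, j), which is nonnegative.\<close>

lemma laurent_keys:
  assumes "P \<in> carrier R" "k \<in> Poly_Mapping.keys (laurent e\<^sub>0 P)"
  shows "fst k + ev (min (snd k) 0) \<in> M"
  using assms
proof (induction arbitrary: k rule: carrier_induct)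
  case (add P Q)
  then show ?case using Poly_Mapping.keys_add[of "laurent e\<^sub>0 P" "laurent e\<^sub>0 Q"]
    by (auto simp: laurent_add)
next
  case (xmon c u i j)
  then have k: "k = (u + ev (int i), int j - int i)" by (auto simp: laurent_xmon split: if_splits)
  have "int i + min (int j - int i) 0 \<ge> 0" by auto
  then have "u + ev (int i + min (int j - int i) 0) \<in> M" using xmon by (intro R_closed)
  then show ?case by (simp add: k add.assoc del: plus_fun_apply)
qed simp

section \<open>Ray ideals in terms of exponents\<close>

lemma tau_y_eq: "tau_y Ed K e\<^sub>0 = cl (xmon 1 0 0 1)"
  and tau_char_eq: "tau_char Ed K e\<^sub>0 u = cl (xmon 1 u 0 0)"
  by (simp_all add: tau_y_def tau_char_def poly_y_eq poly_const_char_eq)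

lemma tau_y_pow:
  "(tau_y Ed K e\<^sub>0 :: ('e, 'k::field) poly_xy set) [^]\<^bsub>A\<^esub> (n::nat) = cl (xmon 1 0 0 n)"
proof -
  interpret cring "A :: ('e, 'k) poly_xy set ring" by (rule cring_A)
  show ?thesis
    by (induction n) (simp_all add: cl_one xmon_one tau_y_eq cl_simps R_closed xmon_mult
        del: zero_fun_apply plus_fun_apply)
qed

lemma tau_y_closed: "tau_y Ed K e\<^sub>0 \<in> carrier A"
  by (simp add: tau_y_eq cl_closed xmon_mem dual_monoid_zero)

lemma tau_char_closed: "u \<in> M \<Longrightarrow> tau_char Ed K e\<^sub>0 u \<in> carrier A"
  by (simp add: tau_char_eq cl_closed xmon_mem)

lemma mult_subset_ray:
  "mult_subset (A :: ('e, 'k::field) poly_xy set ring) (ray_characters Ed K e\<^sub>0 r)"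
proof -
  interpret cring "A :: ('e, 'k) poly_xy set ring" by (rule cring_A)
  show ?thesis
  proof unfold_locales
    show "ray_characters Ed K e\<^sub>0 r \<subseteq> carrier A"
      by (auto simp: ray_characters_def tau_char_closed)
    have "\<one>\<^bsub>A\<^esub> = tau_char Ed K e\<^sub>0 0" by (simp add: tau_char_eq cl_one xmon_one)
    then show "\<one>\<^bsub>A\<^esub> \<in> ray_characters Ed K e\<^sub>0 r"
      by (auto simp: ray_characters_def dual_monoid_zero)
    fix s t :: "('e, 'k) poly_xy set"
    assume "s \<in> ray_characters Ed K e\<^sub>0 r" "t \<in> ray_characters Ed K e\<^sub>0 r"
    then obtain u v where uv: "u \<in> M" "v \<in> M" "pairing Ed u r = 0" "pairing Ed v r = 0"
      "s = tau_char Ed K e\<^sub>0 u" "t = tau_char Ed K e\<^sub>0 v"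
      by (auto simp: ray_characters_def)
    then have "s \<otimes>\<^bsub>A\<^esub> t = tau_char Ed K e\<^sub>0 (u + v)"
      by (simp add: tau_char_eq cl_simps R_closed xmon_mult)
    then show "s \<otimes>\<^bsub>A\<^esub> t \<in> ray_characters Ed K e\<^sub>0 r"
      using uv by (auto simp: ray_characters_def pairing_add dual_monoid_add)
  qed
qed

lemma ray_ideal_eq:
  "(ray_ideal Ed K e\<^sub>0 r n :: ('e, 'k::field) poly_xy set set) =
    mult_subset.saturation A (ray_characters Ed K e\<^sub>0 r) (tau_y Ed K e\<^sub>0 [^]\<^bsub>A\<^esub> n)"
proof -
  interpret mult_subset "A :: ('e, 'k) poly_xy set ring" "ray_characters Ed K e\<^sub>0 r"
    by (rule mult_subset_ray)
  show ?thesis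
    unfolding ray_ideal_def Let_def saturation_def
    by (intro Collect_cong conj_cong refl localization_map_mem_ideal_iff tau_y_closed)
qed

lemma ray_ideal_is_ideal: "ideal (ray_ideal Ed K e\<^sub>0 r n) (A :: ('e, 'k::field) poly_xy set ring)"
proof -
  interpret mult_subset "A :: ('e, 'k) poly_xy set ring" "ray_characters Ed K e\<^sub>0 r"
    by (rule mult_subset_ray)
  show ?thesis unfolding ray_ideal_eq by (intro saturation_ideal nat_pow_closed tau_y_closed)
qed

lemma cl_mem_ray_ideal_iff:
  fixes P :: "('e, 'k::field) poly_xy"
  assumes P: "P \<in> carrier R"
  shows "cl P \<in> ray_ideal Ed K e\<^sub>0 r n \<longleftrightarrow>
    (\<exists>w\<in>M. pairing Ed w r = 0 \<and> (\<exists>Q\<in>carrier R. cl (xmon 1 w 0 0 * P) = cl (Q * xmon 1 0 0 n)))"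
proof -
  interpret mult_subset "A :: ('e, 'k) poly_xy set ring" "ray_characters Ed K e\<^sub>0 r"
    by (rule mult_subset_ray)
  have carrA: "carrier A = cl ` carrier (R :: ('e, 'k) poly_xy ring)"
    using cl_surj by (auto simp: cl_closed)
  have "cl P \<in> ray_ideal Ed K e\<^sub>0 r n \<longleftrightarrow> (\<exists>s\<in>ray_characters Ed K e\<^sub>0 r. \<exists>a\<in>carrier A.
      s \<otimes>\<^bsub>A\<^esub> cl P = a \<otimes>\<^bsub>A\<^esub> cl (xmon 1 0 0 n))"
    by (simp add: ray_ideal_eq saturation_def tau_y_pow cl_closed[OF P])
  also have "\<dots> \<longleftrightarrow> (\<exists>w\<in>M. pairing Ed w r = 0 \<and> (\<exists>Q\<in>carrier R.
      cl (xmon 1 w 0 0) \<otimes>\<^bsub>A\<^esub> cl P = cl Q \<otimes>\<^bsub>A\<^esub> cl (xmon 1 0 0 n)))"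
    unfolding ray_characters_def carrA tau_char_eq by blast
  also have "\<dots> \<longleftrightarrow> (\<exists>w\<in>M. pairing Ed w r = 0 \<and>
      (\<exists>Q\<in>carrier R. cl (xmon 1 w 0 0 * P) = cl (Q * xmon 1 0 0 n)))"
    by (intro bex_cong conj_cong refl) (simp add: cl_simps xmon_mem P dual_monoid_zero)
  finally show ?thesis .
qed

text \<open>In an equation \<chi>^w P = Q y^n the exponent (v, j) of P reappears in Q as (w + v, j -
  n). The exponents of Q satisfy the inequality of \<open>laurent_keys\<close>, and \<open>w\<close>
  is invisible on \<open>r\<close>.\<close>

lemma ray_ideal_keys:
  assumes P: "P \<in> carrier R" "cl P \<in> ray_ideal Ed K e\<^sub>0 r n" and r: "ray r \<subseteq> K"
    and k: "(v, j) \<in> Poly_Mapping.keys (laurent e\<^sub>0 P)"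
  shows "pairing Ed (v + ev (min (j - int n) 0)) r \<ge> 0"
proof -
  obtain w Q where w: "w \<in> M" "pairing Ed w r = 0" and Q: "Q \<in> carrier R"
    and "cl (xmon 1 w 0 0 * P) = cl (Q * xmon 1 0 0 n)"
    using P by (auto simp: cl_mem_ray_ideal_iff)
  then have "laurent e\<^sub>0 (xmon 1 w 0 0 * P) = laurent e\<^sub>0 (xmon 1 0 0 n * Q)"
    using P(1) by (subst (asm) cl_eq_iff_laurent) (auto intro: R_closed simp: mult.commute)
  then have eq: "Poly_Mapping.single (w, 0) 1 * laurent e\<^sub>0 P =
      Poly_Mapping.single (0, int n) 1 * laurent e\<^sub>0 Q"
    by (simp add: laurent_mult laurent_xmon)
  have "Poly_Mapping.lookup (laurent e\<^sub>0 P) (v, j) = Poly_Mapping.lookup (laurent e\<^sub>0 Q) (w + v, j - int n)"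
    using lookup_single_mult[of "(w, 0)" "laurent e\<^sub>0 P" "(v, j)"]
      lookup_single_mult[of "(0, int n)" "laurent e\<^sub>0 Q" "(w + v, j - int n)"]
    by (simp add: eq)
  then have "(w + v, j - int n) \<in> Poly_Mapping.keys (laurent e\<^sub>0 Q)"
    using k by (simp add: in_keys_iff)
  then have "w + (v + ev (min (j - int n) 0)) \<in> M"
    using laurent_keys[OF Q] by (fastforce simp: add.assoc)
  from pairing_ray_nonneg[OF this r] show ?thesis using w by (simp add: pairing_add)
qed

text \<open>The target ideals are spanned by characters, so membership can be established term by
  term. Since every coefficient \<open>c\<close> is allowed in \<open>mem\<close>, applications need
  not track the coefficients of \<open>P\<close>.\<close>

lemma cl_mem_idealI:
  fixes P :: "('e, 'k::field) poly_xy"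
  assumes J: "ideal J A" and P: "P \<in> carrier R"
    and mem: "\<And>k c. k \<in> Poly_Mapping.keys (laurent e\<^sub>0 P) \<Longrightarrow>
      \<exists>Q\<in>carrier R. laurent e\<^sub>0 Q = Poly_Mapping.single k c \<and> cl Q \<in> J"
  shows "cl P \<in> J"
proof -
  interpret J: ideal J "A :: ('e, 'k) poly_xy set ring" by (rule J)
  let ?p = "laurent e\<^sub>0 P"
  have "\<forall>k\<in>Poly_Mapping.keys ?p. \<exists>Q. Q \<in> carrier R \<and>
      laurent e\<^sub>0 Q = Poly_Mapping.single k (Poly_Mapping.lookup ?p k) \<and> cl Q \<in> J"
    using mem by blast
  then obtain Q where Q: "\<And>k. k \<in> Poly_Mapping.keys ?p \<Longrightarrow> Q k \<in> carrier R"
    "\<And>k. k \<in> Poly_Mapping.keys ?p \<Longrightarrow>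
       laurent e\<^sub>0 (Q k) = Poly_Mapping.single k (Poly_Mapping.lookup ?p k)"
    "\<And>k. k \<in> Poly_Mapping.keys ?p \<Longrightarrow> cl (Q k) \<in> J"
    by metis
  have "laurent e\<^sub>0 (\<Sum>k\<in>Poly_Mapping.keys ?p. Q k) = ?p"
    by (simp add: laurent_sum Q sum_single_lookup)
  then have "cl P = cl (\<Sum>k\<in>Poly_Mapping.keys ?p. Q k)"
    using P Q(1) by (subst cl_eq_iff_laurent) (auto intro: R_sum)
  also have "cl (\<Sum>k\<in>X. Q k) \<in> J" if "finite X" "X \<subseteq> Poly_Mapping.keys ?p" for X
    using that
  proof (induction X)
    case empty
    then show ?case using additive_subgroup.zero_closed[OF J.additive_subgroup_axioms]
      by (simp add: cl_zero)
  next
    case (insert k X)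
    have "(\<Sum>k\<in>X. Q k) \<in> carrier R" "Q k \<in> carrier R" using insert.prems Q(1) by (auto intro!: R_sum)
    then have "cl (\<Sum>k\<in>insert k X. Q k) = cl (Q k) \<oplus>\<^bsub>A\<^esub> cl (\<Sum>k\<in>X. Q k)"
      using insert.hyps by (simp add: cl_simps)
    then show ?case using insert Q(3) additive_subgroup.a_closed[OF J.additive_subgroup_axioms] by auto
  qed
  finally show ?thesis by simp
qed

text \<open>The cofactor \<open>Q\<close> is the normal form of c \<chi>^v y^(j - n), which the
  hypothesis places in \<open>R\<close>.\<close>

lemma laurent_monomial_multiple:
  assumes "v + ev (min (j - int n) 0) \<in> M"
  shows "\<exists>Q\<in>carrier R. laurent e\<^sub>0 (Q * xmon 1 0 0 n) = Poly_Mapping.single (v, j) c"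
proof -
  have "ev (min (j - int n) 0) + ev (int (nat (int n - j))) = 0"
    by (auto simp: min_def)
  then have "v + ev (min (j - int n) 0) + ev (int (nat (int n - j))) = v"
    by (simp only: add.assoc add_0_right)
  moreover have "int (nat (j - int n) + n) - int (nat (int n - j)) = j" by auto
  ultimately have "laurent e\<^sub>0 (xmon c (v + ev (min (j - int n) 0)) (nat (int n - j)) (nat (j - int n))
      * xmon 1 0 0 n) = Poly_Mapping.single (v, j) c"
    by (simp only: xmon_mult laurent_xmon add_0_right add_0 mult_1_right)
  then show ?thesis using xmon_mem[OF assms] by blast
qed

end

text \<open>Isolates the input from polyhedral geometry, so that the computation of ideals does not
  refer to graphs.\<close>

locale ray_generated_cone = edge_cone Ed K e\<^sub>0
  for Ed :: "'e set" and K :: "('e \<Rightarrow> real) set" and e\<^sub>0 :: 'e +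
  assumes dual_monoidI: "\<lbrakk>\<And>e. e \<notin> Ed \<Longrightarrow> u e = 0; \<And>r. r \<in> extremal_rays Ed K \<Longrightarrow> pairing Ed u r \<ge> 0\<rbrakk> \<Longrightarrow>
    u \<in> dual_monoid Ed K"
begin

lemma extremal_ray_subset: "r \<in> extremal_rays Ed K \<Longrightarrow> ray r \<subseteq> K"
  by (simp add: extremal_rays_def)

lemma laurent_keys_support:
  assumes "P \<in> carrier R" "(v, j) \<in> Poly_Mapping.keys (laurent e\<^sub>0 P)" "e \<notin> Ed"
  shows "v e = 0"
proof -
  have "e \<noteq> e\<^sub>0" using assms(3) edge by auto
  then show ?thesis
    using laurent_keys[OF assms(1,2)] assms(3) by (auto simp: dual_monoid_def edge_vec_def)
qed

text \<open>The inequalities from all extremal rays combine into v + min(j - n, 0) e \<in>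
  \<open>M\<close>, the condition for divisibility by y^n. The factor \<open>carrier A\<close> keeps
  the left side inside the ring even for an empty family of rays.\<close>

theorem Inter_ray_ideals:
  "carrier (A :: ('e, 'k::field) poly_xy set ring) \<inter> (\<Inter>r\<in>extremal_rays Ed K. ray_ideal Ed K e\<^sub>0 r n) =
    ideal_power A (Idl\<^bsub>A\<^esub> {tau_y Ed K e\<^sub>0}) n"
proof -
  interpret A: cring "A :: ('e, 'k) poly_xy set ring" by (rule cring_A)
  have pow: "ideal_power A (Idl\<^bsub>A\<^esub> {tau_y Ed K e\<^sub>0}) n = PIdl\<^bsub>A\<^esub> (cl (xmon 1 0 0 n) :: ('e, 'k) poly_xy set)"
    by (simp add: A.ideal_power_principal tau_y_closed tau_y_pow)
  have yn: "xmon 1 0 0 n \<in> carrier (R :: ('e, 'k) poly_xy ring)" by (intro R_closed)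
  have J: "ideal (PIdl\<^bsub>A\<^esub> (cl (xmon 1 0 0 n))) (A :: ('e, 'k) poly_xy set ring)"
    using yn by (intro A.cgenideal_ideal) (rule cl_closed)
  show ?thesis
  proof (rule equalityI)
    show "carrier (A :: ('e, 'k) poly_xy set ring) \<inter> (\<Inter>r\<in>extremal_rays Ed K. ray_ideal Ed K e\<^sub>0 r n)
        \<subseteq> ideal_power A (Idl\<^bsub>A\<^esub> {tau_y Ed K e\<^sub>0}) n"
    proof
      fix f :: "('e, 'k) poly_xy set"
      assume "f \<in> carrier A \<inter> (\<Inter>r\<in>extremal_rays Ed K. ray_ideal Ed K e\<^sub>0 r n)"
      then obtain P where P: "P \<in> carrier R" "f = cl P"
        and mem: "\<And>r. r \<in> extremal_rays Ed K \<Longrightarrow> cl P \<in> ray_ideal Ed K e\<^sub>0 r n"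
        by (auto elim: cl_surj)
      have "cl P \<in> PIdl\<^bsub>A\<^esub> (cl (xmon 1 0 0 n))"
      proof (rule cl_mem_idealI[OF J P(1)])
        fix k and c :: 'k
        assume "k \<in> Poly_Mapping.keys (laurent e\<^sub>0 P)"
        then obtain v j where k: "k = (v, j)" "(v, j) \<in> Poly_Mapping.keys (laurent e\<^sub>0 P)"
          by (cases k) auto
        have "v + ev (min (j - int n) 0) \<in> M"
          using ray_ideal_keys[OF P(1) mem extremal_ray_subset k(2)]
            laurent_keys_support[OF P(1) k(2)] edge
          by (intro dual_monoidI) (auto simp: edge_vec_def)
        then obtain Q where Q: "Q \<in> carrier R" "laurent e\<^sub>0 (Q * xmon 1 0 0 n) = Poly_Mapping.single k c"
          using laurent_monomial_multiple k(1) by blast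
        have "cl (Q * xmon 1 0 0 n) = cl Q \<otimes>\<^bsub>A\<^esub> cl (xmon 1 0 0 n)" "cl Q \<in> carrier A"
          using Q(1) yn by (simp_all add: cl_simps cl_closed)
        then have "cl (Q * xmon 1 0 0 n) \<in> PIdl\<^bsub>A\<^esub> (cl (xmon 1 0 0 n))"
          by (auto simp: cgenideal_def)
        then show "\<exists>Q\<in>carrier R. laurent e\<^sub>0 Q = Poly_Mapping.single k c \<and>
            cl Q \<in> PIdl\<^bsub>A\<^esub> (cl (xmon 1 0 0 n))"
          using Q yn R_mult by blast
      qed
      then show "f \<in> ideal_power A (Idl\<^bsub>A\<^esub> {tau_y Ed K e\<^sub>0}) n" by (simp add: P pow)
    qed
    \<comment> \<open>The power itself needs no denominator: take w = 0 and cofactor 1.\<close>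
    have "cl (xmon 1 0 0 n) \<in> (ray_ideal Ed K e\<^sub>0 r n :: ('e, 'k) poly_xy set set)" for r
      unfolding cl_mem_ray_ideal_iff[OF yn]
      by (rule bexI[OF _ dual_monoid_zero], rule conjI[OF pairing_zero], rule bexI[OF _ R_one])
        (simp add: xmon_one)
    then have "PIdl\<^bsub>A\<^esub> (cl (xmon 1 0 0 n)) \<subseteq> (ray_ideal Ed K e\<^sub>0 r n :: ('e, 'k) poly_xy set set)" for r
      by (intro A.cgenideal_minimal[OF ray_ideal_is_ideal])
    then show "ideal_power A (Idl\<^bsub>A\<^esub> {tau_y Ed K e\<^sub>0}) n \<subseteq>
        carrier (A :: ('e, 'k) poly_xy set ring) \<inter> (\<Inter>r\<in>extremal_rays Ed K. ray_ideal Ed K e\<^sub>0 r n)"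
      using additive_subgroup.a_subset[OF ideal.axioms(1)[OF J]] by (auto simp: pow)
  qed
qed

text \<open>
  The generator \<open>y\<^sup>s \<chi>\<^sup>u\<^sup>'\<^sup>'\<close> lies in \<open>I\<^sup>(\<^sup>s\<^sup>+\<^sup>1\<^sup>)\<close> for a ray with \<open>u'(r) = 0\<close> because
  \<open>\<chi>\<^sup>u\<^sup>' y\<^sup>s \<chi>\<^sup>u\<^sup>'\<^sup>' = x y\<^sup>s\<^sup>+\<^sup>1\<close>.
\<close>

theorem Inter_ray_ideals_split:
  assumes u: "u' \<in> M" "u'' \<in> M" and sum: "u' + u'' = ev 1"
    and split: "\<And>r. r \<in> extremal_rays Ed K \<Longrightarrow> pairing Ed u' r = 0 \<or> pairing Ed u'' r = 0"
  shows "carrier (A :: ('e, 'k::field) poly_xy set ring)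
      \<inter> (\<Inter>r\<in>{r \<in> extremal_rays Ed K. pairing Ed u' r = 0}. ray_ideal Ed K e\<^sub>0 r (Suc s))
      \<inter> (\<Inter>r\<in>{r \<in> extremal_rays Ed K. pairing Ed u'' r = 0}. ray_ideal Ed K e\<^sub>0 r s) =
    ideal_prod A (ideal_power A (Idl\<^bsub>A\<^esub> {tau_y Ed K e\<^sub>0}) s)
      (Idl\<^bsub>A\<^esub> {tau_y Ed K e\<^sub>0, tau_char Ed K e\<^sub>0 u''})" (is "?l = ?r")
proof -
  interpret A: cring "A :: ('e, 'k) poly_xy set ring" by (rule cring_A)
  let ?y = "tau_y Ed K e\<^sub>0 :: ('e, 'k) poly_xy set"
  let ?z = "tau_char Ed K e\<^sub>0 u'' :: ('e, 'k) poly_xy set"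
  let ?ys = "cl (xmon 1 0 0 s) :: ('e, 'k) poly_xy set"
  have r_eq: "?r = ideal_prod A (PIdl\<^bsub>A\<^esub> ?ys) (Idl\<^bsub>A\<^esub> {?y, ?z})"
    by (simp add: A.ideal_power_principal tau_y_closed tau_y_pow)
  have closed: "{?y, ?z} \<subseteq> carrier A" "?ys \<in> carrier A"
    using u by (auto simp: tau_y_closed tau_char_closed cl_closed R_closed)
  note gens = A.ideal_prod_principal_gens[OF closed, folded r_eq]
  have gen_y: "?ys \<otimes>\<^bsub>A\<^esub> ?y = cl (xmon 1 0 0 (Suc s))"
    by (simp add: tau_y_eq cl_simps R_closed xmon_mult)
  have gen_z: "?ys \<otimes>\<^bsub>A\<^esub> ?z = cl (xmon 1 u'' 0 s)"
    using u by (simp add: tau_char_eq cl_simps R_closed xmon_mult)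
  have closed_gens: "xmon 1 0 0 (Suc s) \<in> carrier (R :: ('e, 'k) poly_xy ring)"
    "xmon 1 u'' 0 s \<in> carrier (R :: ('e, 'k) poly_xy ring)"
    "xmon 1 u'' 0 0 \<in> carrier (R :: ('e, 'k) poly_xy ring)"
    using u by (auto intro: R_closed)
  have absorb: "cl (Q * G) \<in> ?r" if "Q \<in> carrier R" "G \<in> carrier R" "cl G \<in> ?r"
    for Q G :: "('e, 'k) poly_xy"
    using ideal.I_l_closed[OF gens(1) that(3) cl_closed[OF that(1)]] that by (simp add: cl_simps)
  show ?thesis
  proof (rule equalityI)
    show "?l \<subseteq> ?r"
    proof
      fix f :: "('e, 'k) poly_xy set"
      assume f: "f \<in> ?l"
      then obtain P where P: "P \<in> carrier R" "f = cl P" by (auto elim: cl_surj)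
      have mem': "cl P \<in> ray_ideal Ed K e\<^sub>0 r (Suc s)"
        if "r \<in> extremal_rays Ed K" "pairing Ed u' r = 0" for r
        using f that P by auto
      have mem'': "cl P \<in> ray_ideal Ed K e\<^sub>0 r s"
        if "r \<in> extremal_rays Ed K" "pairing Ed u'' r = 0" for r
        using f that P by auto
      have "cl P \<in> ?r"
      proof (rule cl_mem_idealI[OF gens(1) P(1)])
        fix k and c :: 'k
        assume "k \<in> Poly_Mapping.keys (laurent e\<^sub>0 P)"
        then obtain v j where k: "k = (v, j)" "(v, j) \<in> Poly_Mapping.keys (laurent e\<^sub>0 P)"
          by (cases k) auto
        have ineq': "pairing Ed v r + min (j - int (Suc s)) 0 * r e\<^sub>0 \<ge> 0"
          if "r \<in> extremal_rays Ed K" "pairing Ed u' r = 0" for r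
          using ray_ideal_keys[OF P(1) mem'[OF that] extremal_ray_subset[OF that(1)] k(2)]
          by (simp add: pairing_add pairing_edge_vec[OF finite_edges edge])
        have ineq'': "pairing Ed v r + min (j - int s) 0 * r e\<^sub>0 \<ge> 0"
          if "r \<in> extremal_rays Ed K" "pairing Ed u'' r = 0" for r
          using ray_ideal_keys[OF P(1) mem''[OF that] extremal_ray_subset[OF that(1)] k(2)]
          by (simp add: pairing_add pairing_edge_vec[OF finite_edges edge])
        have supp: "v e = 0" if "e \<notin> Ed" for e using laurent_keys_support[OF P(1) k(2) that] .
        show "\<exists>Q\<in>carrier R. laurent e\<^sub>0 Q = Poly_Mapping.single k c \<and> cl Q \<in> ?r"
        \<comment> \<open>The exponent of y decides which generator divides the character: y^(s +
          1), or y^s \<chi>^u'' if j \<le> s. In the former case both minima vanish, and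
          \<open>split\<close> ensures that every ray supplies an inequality.\<close>
        proof (cases "j \<ge> int (Suc s)")
          case True
          have "v \<in> M"
          proof (rule dual_monoidI)
            fix r assume r: "r \<in> extremal_rays Ed K"
            show "pairing Ed v r \<ge> 0"
              using split[OF r] ineq'[OF r] ineq''[OF r] True by (auto simp: min_def split: if_splits)
          qed (rule supp)
          then have "v + ev (min (j - int (Suc s)) 0) \<in> M" using True by (simp add: min_def)
          from laurent_monomial_multiple[OF this, of c]
          obtain Q where Q: "Q \<in> carrier R"
            "laurent e\<^sub>0 (Q * xmon 1 0 0 (Suc s)) = Poly_Mapping.single k c"
            by (auto simp: k(1))
          show ?thesis
            using Q absorb[OF Q(1) closed_gens(1)] gens(2) closed_gens(1)
            by (intro bexI[of _ "Q * xmon 1 0 0 (Suc s)"]) (auto simp: gen_y R_mult)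
        next
          case False
          \<comment> \<open>The exponent that remains after removing \<chi>^u'', to be tested for
            divisibility by y^s.\<close>
          have "(v - u'') + ev (min (j - int s) 0) \<in> M"
          proof (rule dual_monoidI)
            fix r assume r: "r \<in> extremal_rays Ed K"
            have "pairing Ed (v - u'') r = pairing Ed v r - pairing Ed u'' r"
              using pairing_add[of Ed "v - u''" u'' r] by simp
            then have "pairing Ed (v - u'' + ev (min (j - int s) 0)) r =
                pairing Ed v r - pairing Ed u'' r + min (j - int s) 0 * r e\<^sub>0"
              by (simp only: pairing_add pairing_edge_vec[OF finite_edges edge] of_int_eq_id id_apply)
            moreover have "pairing Ed u' r + pairing Ed u'' r = r e\<^sub>0"
              using pairing_add[of Ed u' u'' r] pairing_edge_vec[OF finite_edges edge, of 1 r]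
              by (simp add: sum)
            \<comment> \<open>If u'(r) = 0, then u''(r) = e(r), and j \<le> s gives min(j - (s + 1),
              0) = min(j - s, 0) - 1: the extra 1 in the exponent pays for subtracting u''. If
              u''(r) = 0, nothing is subtracted and \<open>ineq''\<close> suffices.\<close>
            ultimately show "pairing Ed (v - u'' + ev (min (j - int s) 0)) r \<ge> 0"
              using split[OF r] ineq'[OF r] ineq''[OF r] False
              by (auto simp: min_def algebra_simps split: if_splits)
          next
            fix e assume "e \<notin> Ed"
            then show "(v - u'' + ev (min (j - int s) 0)) e = 0"
              using supp[of e] u(2) edge by (auto simp: dual_monoid_def edge_vec_def)
          qed
          from laurent_monomial_multiple[OF this, of c]
          obtain Q where Q: "Q \<in> carrier R"
            "laurent e\<^sub>0 (Q * xmon 1 0 0 s) = Poly_Mapping.single (v - u'', j) c"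
            by auto
          have "Q * xmon 1 u'' 0 s = (Q * xmon 1 0 0 s) * xmon 1 u'' 0 0"
            by (simp add: mult.assoc xmon_mult)
          then have "laurent e\<^sub>0 (Q * xmon 1 u'' 0 s) =
              Poly_Mapping.single (v - u'', j) c * Poly_Mapping.single (u'', 0) 1"
            by (simp only: laurent_mult[of e\<^sub>0 "Q * xmon 1 0 0 s"] Q(2)) (simp add: laurent_xmon)
          then have "laurent e\<^sub>0 (Q * xmon 1 u'' 0 s) = Poly_Mapping.single k c"
            by (simp add: mult_single k(1))
          then show ?thesis
            using Q(1) absorb[OF Q(1) closed_gens(2)] gens(3) closed_gens(2)
            by (intro bexI[of _ "Q * xmon 1 u'' 0 s"]) (auto simp: gen_z R_mult)
        qed
      qed
      then show "f \<in> ?r" by (simp add: P)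
    qed
  next
    \<comment> \<open>The cofactor is 1 for the exponent \<open>Suc s\<close> and y for the exponent
      \<open>s\<close>.\<close>
    have y_mem: "cl (xmon 1 0 0 (Suc s)) \<in> (ray_ideal Ed K e\<^sub>0 r (Suc s) :: ('e, 'k) poly_xy set set)"
      "cl (xmon 1 0 0 (Suc s)) \<in> (ray_ideal Ed K e\<^sub>0 r s :: ('e, 'k) poly_xy set set)" for r
      unfolding cl_mem_ray_ideal_iff[OF closed_gens(1)]
      by (intro bexI[OF _ dual_monoid_zero] conjI pairing_zero bexI[of _ 1] bexI[of _ "xmon 1 0 0 1"]
          R_closed; simp add: xmon_mult flip: xmon_one)+
    have z_mem'': "cl (xmon 1 u'' 0 s) \<in> (ray_ideal Ed K e\<^sub>0 r s :: ('e, 'k) poly_xy set set)" for r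
      unfolding cl_mem_ray_ideal_iff[OF closed_gens(2)]
      by (intro bexI[OF _ dual_monoid_zero] conjI pairing_zero bexI[OF _ closed_gens(3)])
        (simp add: xmon_mult)
    have z_mem': "cl (xmon 1 u'' 0 s) \<in> (ray_ideal Ed K e\<^sub>0 r (Suc s) :: ('e, 'k) poly_xy set set)"
      if "pairing Ed u' r = 0" for r
      unfolding cl_mem_ray_ideal_iff[OF closed_gens(2)]
    proof (intro bexI[OF _ u(1)] conjI that bexI[of _ "xmon 1 0 1 0"])
      show "cl (xmon 1 u' 0 0 * xmon 1 u'' 0 s) = (cl (xmon 1 0 1 0 * xmon 1 0 0 (Suc s)) :: ('e, 'k) poly_xy set)"
        unfolding xmon_mult sum
        by (subst cl_eq_iff_laurent) (auto intro!: xmon_mem ev_mem dual_monoid_zero simp: laurent_xmon)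
    qed (intro R_closed)
    have "?r \<subseteq> ray_ideal Ed K e\<^sub>0 r (Suc s)" if "pairing Ed u' r = 0" for r
      unfolding r_eq using y_mem(1) z_mem'[OF that]
      by (intro A.ideal_prod_principal_subset ray_ideal_is_ideal closed) (simp_all add: gen_y gen_z)
    moreover have "?r \<subseteq> ray_ideal Ed K e\<^sub>0 r s" for r
      unfolding r_eq using y_mem(2) z_mem''
      by (intro A.ideal_prod_principal_subset ray_ideal_is_ideal closed) (simp_all add: gen_y gen_z)
    moreover have "?r \<subseteq> carrier A"
      using additive_subgroup.a_subset[OF ideal.axioms(1)[OF gens(1)]] .
    ultimately show "?r \<subseteq> ?l" by blast
  qed
qed

end


section \<open>Flow cones\<close>

lemma fin_digraph_orientation:
  assumes "fin_digraph G" "orientation G D"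
  shows "fin_digraph D"
proof -
  interpret fin_digraph G by fact
  have "tail D e \<in> verts D \<and> head D e \<in> verts D" if "e \<in> arcs D" for e
  proof -
    have "{tail D e, head D e} = {tail G e, head G e}" "e \<in> arcs G" "verts D = verts G"
      using assms(2) that by (auto simp: orientation_def)
    then show ?thesis by (metis doubleton_eq_iff head_in_verts tail_in_verts)
  qed
  moreover have "verts D = verts G" "arcs D = arcs G" using assms(2) by (auto simp: orientation_def)
  ultimately show ?thesis by unfold_locales auto
qed

fun under_edge :: "'e sub_edge \<Rightarrow> 'e" where
  "under_edge (Whole e) = e"
| "under_edge (First_Half e) = e"
| "under_edge (Second_Half e) = e"

lemma under_edge_edges_over: "d \<in> edges_over \<E> e \<Longrightarrow> under_edge d = e"
  by (auto simp: edges_over_def split: if_splits)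

lemma finite_edges_over [simp]: "finite (edges_over \<E> e)"
  by (simp add: edges_over_def)

lemma subdivision_simps [simp]:
  "verts (subdivision \<Gamma> \<E>) = Original ` verts \<Gamma> \<union> Exceptional ` \<E>"
  "arcs (subdivision \<Gamma> \<E>) = (\<Union>e\<in>arcs \<Gamma>. edges_over \<E> e)"
  "tail (subdivision \<Gamma> \<E>) = sub_tail \<Gamma>" "head (subdivision \<Gamma> \<E>) = sub_head \<Gamma>"
  by (simp_all add: subdivision_def)

lemma fin_digraph_subdivision:
  assumes "fin_digraph \<Gamma>" "\<E> \<subseteq> arcs \<Gamma>"
  shows "fin_digraph (subdivision \<Gamma> \<E>)"
proof -
  interpret fin_digraph \<Gamma> by fact
  show ?thesis using assms(2) finite_subset[OF assms(2) finite_arcs]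
    by unfold_locales (auto simp: edges_over_def split: if_splits)
qed

text \<open>Adjacent vertices of the symmetrized graph are the ends of an edge, so equality
  propagates along paths. Applied to the difference of two potentials, it shows that their
  increments determine them up to a constant.\<close>

lemma connected_constant:
  assumes conn: "Digraph_Component.connected G" and wf: "wf_digraph G"
    and adj: "\<And>e. e \<in> arcs G \<Longrightarrow> h (tail G e) = h (head G e)"
    and uv: "u \<in> verts G" "v \<in> verts G"
  shows "h u = h v"
proof -
  have "u \<rightarrow>\<^sup>*\<^bsub>with_proj (mk_symmetric G)\<^esub> v"
    using conn uv by (auto simp: Digraph_Component.connected_def strongly_connected_def)
  then show ?thesis unfolding reachable_def
  proof (induction rule: rtrancl_on_induct)
    case (step v w)
    then have "(v, w) \<in> parcs (mk_symmetric G)" by (simp add: arcs_ends_conv)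
    then obtain e where "e \<in> arcs G" "(v, w) = (tail G e, head G e) \<or> (v, w) = (head G e, tail G e)"
      by (auto simp: parcs_mk_symmetric)
    then show ?case using step.IH adj by auto
  qed simp
qed

locale flow_graph =
  fixes \<Gamma> :: "('v, 'e) pre_digraph" and \<E> :: "'e set"
    and D :: "(('v, 'e) sub_vertex, 'e sub_edge) pre_digraph" and \<phi> :: "'e sub_edge \<Rightarrow> nat"
  assumes fin: "fin_digraph \<Gamma>" and nondisc: "nondisconnecting \<Gamma> \<E>"
    and orient: "orientation (subdivision \<Gamma> \<E>) D"
    and div: "e \<in> \<E> \<Longrightarrow> flow_div D \<phi> (Exceptional e) = -1"
begin

sublocale \<Gamma>: fin_digraph \<Gamma> by (rule fin)

lemma E_subset: "\<E> \<subseteq> arcs \<Gamma>"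
  using nondisc by (simp add: nondisconnecting_def)

sublocale D: fin_digraph D
  by (rule fin_digraph_orientation[OF fin_digraph_subdivision[OF fin E_subset] orient])

abbreviation C where "C \<equiv> subdivided_cone D \<phi>"

lemma arcs_D: "arcs D = (\<Union>e\<in>arcs \<Gamma>. edges_over \<E> e)"
  using orient by (simp add: orientation_def)

text \<open>
  The flow along an edge, with the sign that compares the orientation with the fixed one of the
  subdivision; it is unaffected by reversing edges of zero flow.
\<close>

definition slope :: "'e sub_edge \<Rightarrow> int" where
  "slope d = (if tail D d = sub_tail \<Gamma> d then int (\<phi> d) else - int (\<phi> d))"

lemma ends_D:
  assumes "d \<in> arcs D"
  shows "tail D d = sub_tail \<Gamma> d \<and> head D d = sub_head \<Gamma> d \<or>
    tail D d = sub_head \<Gamma> d \<and> head D d = sub_tail \<Gamma> d"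
  using assms orient by (auto simp: orientation_def doubleton_eq_iff)

lemma potential_slope:
  assumes "d \<in> arcs D"
  shows "f (head D d) - f (tail D d) = real (\<phi> d) * x \<longleftrightarrow>
    f (sub_head \<Gamma> d) - f (sub_tail \<Gamma> d) = of_int (slope d) * x"
  using ends_D[OF assms] by (auto simp: slope_def)

lemma cone_iff_slope:
  "x \<in> C \<longleftrightarrow> (\<forall>d. d \<notin> arcs D \<longrightarrow> x d = 0) \<and> (\<forall>d\<in>arcs D. x d \<ge> 0) \<and>
    (\<exists>f. \<forall>d\<in>arcs D. f (sub_head \<Gamma> d) - f (sub_tail \<Gamma> d) = of_int (slope d) * x d)"
  unfolding subdivided_cone_iff_potential[OF D.fin_digraph]
  by (simp add: potential_slope cong: ball_cong)

lemma half_arcs: "e \<in> \<E> \<Longrightarrow> First_Half e \<in> arcs D \<and> Second_Half e \<in> arcs D"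
  using E_subset by (auto simp: arcs_D edges_over_def)

text \<open>Whatever the orientation, the signed flow enters the exceptional vertex through the
  first half and leaves through the second, so the divergence is the difference of the two
  slopes.\<close>

lemma slope_halves:
  assumes e: "e \<in> \<E>"
  shows "slope (Second_Half e) = slope (First_Half e) + 1"
proof -
  have halves: "d = First_Half e \<or> d = Second_Half e"
    if "d \<in> arcs D" "tail D d = Exceptional e \<or> head D d = Exceptional e" for d
    using ends_D[OF that(1)] that(2) by (cases d) auto
  have restrict: "(\<Sum>d | d \<in> arcs D \<and> h d = Exceptional e. int (\<phi> d)) =
      (\<Sum>d\<in>{First_Half e, Second_Half e}. if h d = Exceptional e then int (\<phi> d) else 0)"
    if "\<And>d. d \<in> arcs D \<Longrightarrow> h d = Exceptional e \<Longrightarrow> d = First_Half e \<or> d = Second_Half e" for h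
  proof -
    have "{d. d \<in> arcs D \<and> h d = Exceptional e} =
        {d \<in> {First_Half e, Second_Half e}. h d = Exceptional e}"
      using that half_arcs[OF e] by auto
    then show ?thesis by (simp only: sum.inter_filter finite.intros)
  qed
  have "flow_div D \<phi> (Exceptional e) = slope (First_Half e) - slope (Second_Half e)"
    unfolding flow_div_def using halves ends_D[of "First_Half e"] ends_D[of "Second_Half e"] half_arcs[OF e]
    by (subst (1 2) restrict) (auto simp: slope_def)
  then show ?thesis using div[OF e] by simp
qed

text \<open>Polymorphic because the generator of a ray is projected over the integers, its multiples
  over the reals.\<close>

definition proj :: "('e sub_edge \<Rightarrow> 'a::comm_monoid_add) \<Rightarrow> 'e \<Rightarrow> 'a" where
  "proj x = (\<lambda>e. if e \<in> arcs \<Gamma> then \<Sum>d\<in>edges_over \<E> e. x d else 0)"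

lemma flow_cone_eq: "flow_cone \<Gamma> \<E> D \<phi> = proj ` C"
  by (simp add: flow_cone_def proj_def[abs_def])

lemma proj_add: "proj (\<lambda>d. x d + y d) = proj x + proj y"
  by (auto simp: proj_def sum.distrib)

lemma proj_scale: "proj (\<lambda>d. t * x d) = (\<lambda>e. t * proj x e)" for t :: real
  by (auto simp: proj_def sum_distrib_left)

lemma proj_of_int: "proj (\<lambda>d. of_int (z d)) = (\<lambda>e. of_int (proj z e) :: real)"
  by (auto simp: proj_def)

lemma cone_nonneg: "x \<in> C \<Longrightarrow> x d \<ge> 0"
  by (cases "d \<in> arcs D") (auto simp: subdivided_cone_def)

lemma proj_nonneg: "x \<in> C \<Longrightarrow> proj x e \<ge> 0"
  by (simp add: proj_def sum_nonneg cone_nonneg)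

lemma cone_add:
  assumes "x \<in> C" "y \<in> C"
  shows "(\<lambda>d. x d + y d) \<in> C"
  using assms by (auto simp: subdivided_cone_def distrib_left sum.distrib)

lemma cone_scale:
  assumes "x \<in> C" "t \<ge> 0"
  shows "(\<lambda>d. t * x d) \<in> C"
  using assms unfolding subdivided_cone_def
  by (auto simp: mult.left_commute[of _ t] simp flip: sum_distrib_left)

text \<open>Edges outside \<E> are read off directly, and they fix the potential on the original
  vertices up to a constant. For a subdivided edge the total length and the potential drop are then
  known; they determine both halves because the slopes differ by 1.\<close>

lemma proj_inj:
  assumes x: "x \<in> C" and y: "y \<in> C" and eq: "proj x = proj y"
  shows "x = y"
proof
  fix d
  obtain f where f: "\<And>d. d \<in> arcs D \<Longrightarrow> f (sub_head \<Gamma> d) - f (sub_tail \<Gamma> d) = of_int (slope d) * x d"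
    using x by (auto simp: cone_iff_slope)
  obtain g where g: "\<And>d. d \<in> arcs D \<Longrightarrow> g (sub_head \<Gamma> d) - g (sub_tail \<Gamma> d) = of_int (slope d) * y d"
    using y by (auto simp: cone_iff_slope)
  have whole: "x (Whole e) = y (Whole e)" if "e \<in> arcs \<Gamma>" "e \<notin> \<E>" for e
    using fun_cong[OF eq, of e] that by (simp add: proj_def edges_over_def)
  define h where "h v = f (Original v) - g (Original v)" for v
  have h: "h u = h v" if "u \<in> verts \<Gamma>" "v \<in> verts \<Gamma>" for u v
  proof (rule connected_constant[of "\<Gamma>\<lparr>arcs := arcs \<Gamma> - \<E>\<rparr>" h])
    show "Digraph_Component.connected (\<Gamma>\<lparr>arcs := arcs \<Gamma> - \<E>\<rparr>)"
      using nondisc by (simp add: nondisconnecting_def)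
    show "wf_digraph (\<Gamma>\<lparr>arcs := arcs \<Gamma> - \<E>\<rparr>)" by unfold_locales auto
    fix e assume "e \<in> arcs (\<Gamma>\<lparr>arcs := arcs \<Gamma> - \<E>\<rparr>)"
    then have e: "e \<in> arcs \<Gamma>" "e \<notin> \<E>" by auto
    then have "Whole e \<in> arcs D" by (auto simp: arcs_D edges_over_def)
    from f[OF this] g[OF this] whole[OF e]
    show "h (tail (\<Gamma>\<lparr>arcs := arcs \<Gamma> - \<E>\<rparr>) e) = h (head (\<Gamma>\<lparr>arcs := arcs \<Gamma> - \<E>\<rparr>) e)"
      by (simp add: h_def)
  qed (use that in auto)
  have halves: "x (First_Half e) = y (First_Half e) \<and> x (Second_Half e) = y (Second_Half e)"
    if e: "e \<in> \<E>" for e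
  proof -
    have e': "e \<in> arcs \<Gamma>" using e E_subset by auto
    have sum: "x (First_Half e) + x (Second_Half e) = y (First_Half e) + y (Second_Half e)"
      using fun_cong[OF eq, of e] e e' by (simp add: proj_def edges_over_def)
    let ?s = "real_of_int (slope (First_Half e))"
    have "?s * x (First_Half e) + (?s + 1) * x (Second_Half e) =
        ?s * y (First_Half e) + (?s + 1) * y (Second_Half e)"
      using f[of "First_Half e"] f[of "Second_Half e"] g[of "First_Half e"] g[of "Second_Half e"]
        half_arcs[OF e] h[of "tail \<Gamma> e" "head \<Gamma> e"] e'
      by (simp add: slope_halves[OF e] h_def)
    \<comment> \<open>The drop is the first slope times the total length plus the length of the
      second half, which isolates the latter.\<close>
    then have "?s * (x (First_Half e) + x (Second_Half e)) + x (Second_Half e) =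
        ?s * (y (First_Half e) + y (Second_Half e)) + y (Second_Half e)"
      by (simp add: algebra_simps)
    then show ?thesis using sum by simp
  qed
  show "x d = y d"
  proof (cases "d \<in> arcs D")
    case True
    then show ?thesis using whole halves
      by (auto simp: arcs_D edges_over_def split: if_splits)
  next
    case False
    then show ?thesis using x y by (simp add: subdivided_cone_def)
  qed
qed

text \<open>The pullback of a functional gives each edge of the subdivision the coefficient of the
  edge below it. This moves the search for a violating ray up to \<open>C\<close>.\<close>

lemma pairing_proj:
  "pairing (arcs \<Gamma>) u (proj x) = (\<Sum>d\<in>arcs D. of_int (u (under_edge d)) * x d)"
proof -
  have "(\<Sum>d\<in>arcs D. of_int (u (under_edge d)) * x d) =
      (\<Sum>e\<in>arcs \<Gamma>. \<Sum>d\<in>edges_over \<E> e. of_int (u (under_edge d)) * x d)"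
    unfolding arcs_D
    by (intro sum.UNION_disjoint) (auto simp: edges_over_def split: if_splits)
  also have "\<dots> = pairing (arcs \<Gamma>) u (proj x)"
    unfolding pairing_def proj_def
    by (intro sum.cong) (auto simp: sum_distrib_left under_edge_edges_over intro!: sum.cong)
  finally show ?thesis by simp
qed

lemma cone_eq_rational_cone:
  "C = rational_cone (arcs D) ((\<lambda>\<gamma> d. cycle_sign \<gamma> d * int (\<phi> d)) ` {\<gamma>. undirected_cycle D \<gamma>})"
  by (auto simp: subdivided_cone_def rational_cone_def)

text \<open>
  A functional that is negative somewhere is negative on an integral generator of an extremal ray
  of \<open>C\<close>; since the projection is injective on \<open>C\<close>, its image spans an extremal ray as well.
\<close>

lemma dual_monoid_extremal_raysI:
  fixes u :: "'e \<Rightarrow> int"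
  assumes supp: "\<And>e. e \<notin> arcs \<Gamma> \<Longrightarrow> u e = 0"
    and nonneg: "\<And>r. r \<in> extremal_rays (arcs \<Gamma>) (proj ` C) \<Longrightarrow> pairing (arcs \<Gamma>) u r \<ge> 0"
  shows "u \<in> dual_monoid (arcs \<Gamma>) (proj ` C)"
proof (rule ccontr)
  assume "u \<notin> dual_monoid (arcs \<Gamma>) (proj ` C)"
  then obtain x\<^sub>0 where x\<^sub>0: "x\<^sub>0 \<in> C" "pairing (arcs \<Gamma>) u (proj x\<^sub>0) < 0"
    using supp by (auto simp: dual_monoid_def not_le)
  obtain z :: "'e sub_edge \<Rightarrow> int" where z: "(\<lambda>d. of_int (z d)) \<in> C"
    and neg: "(\<Sum>d\<in>arcs D. of_int (u (under_edge d)) * real_of_int (z d)) < 0"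
    and gen: "\<And>x. x \<in> C \<Longrightarrow> (\<And>d. z d = 0 \<Longrightarrow> x d = 0) \<Longrightarrow> \<exists>t\<ge>0. x = (\<lambda>d. t * of_int (z d))"
    using rational_cone_extremal_generator[OF D.finite_arcs x\<^sub>0(1)[unfolded cone_eq_rational_cone],
        of "\<lambda>d. of_int (u (under_edge d))"] x\<^sub>0(2)
    unfolding pairing_proj cone_eq_rational_cone[symmetric] by blast
  \<comment> \<open>The projection of \<open>z\<close> need not be primitive, so its common divisor
    is removed.\<close>
  define g where "g = Gcd (proj z ` arcs \<Gamma>)"
  define r where "r e = proj z e div g" for e
  have gr: "proj z e = g * r e" for e
    by (cases "e \<in> arcs \<Gamma>") (auto simp: g_def r_def proj_def)
  have pairing_z: "pairing (arcs \<Gamma>) u (proj z) < 0"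
    using neg pairing_proj[of u "\<lambda>d. real_of_int (z d)"] by (simp add: proj_of_int pairing_of_int)
  have "g \<noteq> 0"
  proof
    assume "g = 0"
    then have "proj z = 0" using gr by auto
    then show False using pairing_z by (simp add: pairing_def)
  qed
  moreover have "g \<ge> 0" by (simp add: g_def)
  ultimately have g: "g > 0" by simp
  have proj_z: "proj (\<lambda>d. t * of_int (z d)) = (\<lambda>e. (t * of_int g) * of_int (r e))" for t :: real
    unfolding proj_scale proj_of_int gr by (simp add: mult.assoc)
  have "r \<in> extremal_rays (arcs \<Gamma>) (proj ` C)"
    unfolding extremal_rays_def
  proof (intro CollectI conjI allI impI ballI)
    show "r e = 0" if "e \<notin> arcs \<Gamma>" for e using that by (simp add: r_def proj_def)
    have "proj z ` arcs \<Gamma> = (*) g ` r ` arcs \<Gamma>" by (auto simp: image_image gr)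
    then have "g = normalize (g * Gcd (r ` arcs \<Gamma>))" by (metis g_def Gcd_mult)
    then show "Gcd (r ` arcs \<Gamma>) = 1" using g by (simp add: abs_mult)
    show "ray r \<subseteq> proj ` C"
    proof
      fix v assume "v \<in> ray r"
      then obtain c where c: "c \<ge> 0" "v = (\<lambda>e. c * of_int (r e))" by (auto simp: ray_def)
      then have "v = proj (\<lambda>d. (c / of_int g) * of_int (z d))" unfolding proj_z using g by simp
      then show "v \<in> proj ` C" using cone_scale[OF z, of "c / of_int g"] c g by auto
    qed
    have ext: "v \<in> ray r" if vw: "v \<in> proj ` C" "w \<in> proj ` C" "v + w \<in> ray r" for v w
    proof -
      obtain x x' where x: "x \<in> C" "v = proj x" "x' \<in> C" "w = proj x'" using vw by auto
      obtain c where c: "c \<ge> 0" "v + w = (\<lambda>e. c * of_int (r e))" using vw by (auto simp: ray_def)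
      have "proj (\<lambda>d. x d + x' d) = proj (\<lambda>d. (c / of_int g) * of_int (z d))"
        unfolding proj_z using c g by (simp add: proj_add x)
      then have eq: "(\<lambda>d. x d + x' d) = (\<lambda>d. (c / of_int g) * of_int (z d))"
        using x c g by (intro proj_inj cone_add cone_scale z) auto
      \<comment> \<open>Two nonnegative numbers with sum 0 vanish, so \<open>x\<close> is supported
        where \<open>z\<close> is, and \<open>gen\<close> applies.\<close>
      have "x d = 0" if "z d = 0" for d
        using fun_cong[OF eq, of d] cone_nonneg[OF x(1), of d] cone_nonneg[OF x(3), of d] that
        by simp
      then obtain t where "t \<ge> 0" "x = (\<lambda>d. t * of_int (z d))" using gen[OF x(1)] by blast
      then have "v = (\<lambda>e. (t * of_int g) * of_int (r e))" "t * of_int g \<ge> 0"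
        using g unfolding x(2) proj_z[symmetric] by simp_all
      then show ?thesis unfolding ray_def by blast
    qed
    fix v w assume "v \<in> proj ` C" "w \<in> proj ` C" "v + w \<in> ray r"
    then show "v \<in> ray r" "w \<in> ray r" using ext[of v w] ext[of w v] by (auto simp: add.commute)
  qed
  from nonneg[OF this] have "g * pairing (arcs \<Gamma>) u r \<ge> 0" using g by simp
  also have "g * pairing (arcs \<Gamma>) u r = pairing (arcs \<Gamma>) u (proj z)"
    using pairing_scale[of "arcs \<Gamma>" u g r] by (simp add: gr[symmetric])
  finally show False using pairing_z by simp
qed

lemma ray_generated:
  assumes "e\<^sub>0 \<in> arcs \<Gamma>"
  shows "ray_generated_cone (arcs \<Gamma>) (flow_cone \<Gamma> \<E> D \<phi>) e\<^sub>0"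
  unfolding flow_cone_eq
  by unfold_locales (use assms proj_nonneg dual_monoid_extremal_raysI in auto)

end

section \<open>The two functionals of a subdivided edge and the splitting of its halves\<close>

locale subdivided_edge = flow_graph +
  fixes T es et \<gamma> e\<^sub>0
  assumes tree: "spanning_tree_edges \<Gamma> T" "T \<inter> \<E> = {}"
    and e\<^sub>0: "e\<^sub>0 \<in> \<E>"
    and halves: "{es, et} = edges_over \<E> e\<^sub>0"
    and es: "head D es = Exceptional e\<^sub>0" and et: "tail D et = Exceptional e\<^sub>0"
    and cycle: "undirected_cycle D \<gamma>" "fst ` set \<gamma> \<subseteq> {es, et} \<union> Whole ` T"
    and signs: "cycle_sign \<gamma> es = 1" "cycle_sign \<gamma> et = 1"
begin

abbreviation u' where "u' \<equiv> u_prime \<phi> T \<gamma> e\<^sub>0 es"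
abbreviation u'' where "u'' \<equiv> u_second \<phi> T \<gamma> e\<^sub>0 et"

lemma halves_cases: "es = First_Half e\<^sub>0 \<and> et = Second_Half e\<^sub>0 \<or> es = Second_Half e\<^sub>0 \<and> et = First_Half e\<^sub>0"
  using halves e\<^sub>0 by (auto simp: edges_over_def doubleton_eq_iff)

lemma es_neq_et: "es \<noteq> et"
  using halves_cases by auto

lemma half_arcs': "es \<in> arcs D" "et \<in> arcs D"
  using halves_cases half_arcs[OF e\<^sub>0] by auto

lemma e\<^sub>0_arc: "e\<^sub>0 \<in> arcs \<Gamma>"
  using e\<^sub>0 E_subset by auto

text \<open>The slopes of the halves are their flows, or both negatives of them if \<open>es\<close>
  is the second half. The change of sign comes with the exchange of the halves, so the extra unit
  lands on \<open>et\<close> in both cases.\<close>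

lemma flow_halves: "\<phi> et = Suc (\<phi> es)"
proof -
  consider "es = First_Half e\<^sub>0" "et = Second_Half e\<^sub>0" | "es = Second_Half e\<^sub>0" "et = First_Half e\<^sub>0"
    using halves_cases by blast
  then show ?thesis
  proof cases
    case 1
    then have "tail D es = sub_tail \<Gamma> es" using ends_D[OF half_arcs'(1)] es by auto
    then have "slope es = int (\<phi> es)" "slope et = int (\<phi> et)"
      using et 1 by (simp_all add: slope_def)
    then show ?thesis using slope_halves[OF e\<^sub>0] 1 by simp
  next
    case 2
    then have "tail D es \<noteq> sub_tail \<Gamma> es" using ends_D[OF half_arcs'(1)] es by auto
    then have "slope es = - int (\<phi> es)" "slope et = - int (\<phi> et)"
      using et 2 by (simp_all add: slope_def)
    then show ?thesis using slope_halves[OF e\<^sub>0] 2 by simp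
  qed
qed

lemma T_subset: "T \<subseteq> arcs \<Gamma>" "e\<^sub>0 \<notin> T"
  using tree e\<^sub>0 by (auto simp: spanning_tree_edges_def)

lemma T_finite: "finite T"
  using finite_subset[OF T_subset(1)] by simp

text \<open>The equation of the cycle \<gamma>, reduced to the edges it may use. It trades the tree
  part of \<open>u'\<close> and \<open>u''\<close> for the lengths of the two halves.\<close>

lemma cycle_relation:
  assumes x: "x \<in> C"
  shows "real (\<phi> es) * x es + real (\<phi> et) * x et +
    (\<Sum>e\<in>T. of_int (cycle_sign \<gamma> (Whole e)) * real (\<phi> (Whole e)) * x (Whole e)) = 0"
proof -
  let ?F = "\<lambda>d. of_int (cycle_sign \<gamma> d) * real (\<phi> d) * x d"
  have sub: "{es, et} \<union> Whole ` T \<subseteq> arcs D"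
    using half_arcs' T_subset tree(2) by (auto simp: arcs_D edges_over_def)
  have zero: "cycle_sign \<gamma> d = 0" if "d \<notin> {es, et} \<union> Whole ` T" for d
  proof -
    have "d \<notin> fst ` set \<gamma>" using cycle(2) that by blast
    then show ?thesis by (force simp: cycle_sign_def)
  qed
  have "0 = (\<Sum>d\<in>arcs D. ?F d)" using x cycle(1) by (simp add: subdivided_cone_def)
  also have "\<dots> = (\<Sum>d\<in>{es, et} \<union> Whole ` T. ?F d)"
    using sub zero by (intro sum.mono_neutral_right) auto
  also have "\<dots> = (\<Sum>d\<in>{es, et}. ?F d) + (\<Sum>d\<in>Whole ` T. ?F d)"
    using halves_cases T_finite by (intro sum.union_disjoint) auto
  also have "(\<Sum>d\<in>Whole ` T. ?F d) = (\<Sum>e\<in>T. ?F (Whole e))"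
    by (subst sum.reindex) (auto simp: inj_on_def)
  finally show ?thesis using es_neq_et signs by simp
qed

lemma pairing_tree:
  assumes "\<And>e. e \<in> arcs \<Gamma> \<Longrightarrow> e \<noteq> e\<^sub>0 \<Longrightarrow> e \<notin> T \<Longrightarrow> u e = 0"
  shows "pairing (arcs \<Gamma>) u (proj x) =
    of_int (u e\<^sub>0) * (x es + x et) + (\<Sum>e\<in>T. of_int (u e) * x (Whole e))"
proof -
  have "pairing (arcs \<Gamma>) u (proj x) = (\<Sum>e\<in>insert e\<^sub>0 T. of_int (u e) * proj x e)"
    unfolding pairing_def using assms T_subset e\<^sub>0_arc by (intro sum.mono_neutral_right) auto
  also have "\<dots> = of_int (u e\<^sub>0) * proj x e\<^sub>0 + (\<Sum>e\<in>T. of_int (u e) * proj x e)"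
    using T_finite T_subset by simp
  also have "proj x e\<^sub>0 = x es + x et"
    using e\<^sub>0_arc es_neq_et by (simp add: proj_def flip: halves)
  also have "(\<Sum>e\<in>T. of_int (u e) * proj x e) = (\<Sum>e\<in>T. of_int (u e) * x (Whole e))"
    using T_subset tree(2) by (intro sum.cong) (auto simp: proj_def edges_over_def)
  finally show ?thesis .
qed

text \<open>By the cycle relation the tree contributes
  \<open>\<phi> es * x es + \<phi> et * x et\<close>; the coefficient of \<open>e\<^sub>0\<close>
  subtracts \<open>\<phi> es * (x es + x et)\<close>, and \<open>\<phi> et - \<phi> es = 1\<close>
  leaves \<open>x et\<close>.\<close>

lemma pairing_u_prime:
  assumes "x \<in> C"
  shows "pairing (arcs \<Gamma>) u' (proj x) = x et"
proof -
  have "(\<Sum>e\<in>T. of_int (u' e) * x (Whole e)) =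
      - (\<Sum>e\<in>T. of_int (cycle_sign \<gamma> (Whole e)) * real (\<phi> (Whole e)) * x (Whole e))"
    unfolding sum_negf[symmetric] using T_subset by (intro sum.cong) (auto simp: u_prime_def)
  then show ?thesis
    using cycle_relation[OF assms] by (subst pairing_tree) (auto simp: u_prime_def flow_halves algebra_simps)
qed

lemma pairing_u_second:
  assumes "x \<in> C"
  shows "pairing (arcs \<Gamma>) u'' (proj x) = x es"
proof -
  have "(\<Sum>e\<in>T. of_int (u'' e) * x (Whole e)) =
      (\<Sum>e\<in>T. of_int (cycle_sign \<gamma> (Whole e)) * real (\<phi> (Whole e)) * x (Whole e))"
    using T_subset by (intro sum.cong) (auto simp: u_second_def)
  then show ?thesis
    using cycle_relation[OF assms] by (subst pairing_tree) (auto simp: u_second_def flow_halves algebra_simps)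
qed

lemma u_dual:
  "u' \<in> dual_monoid (arcs \<Gamma>) (proj ` C)" "u'' \<in> dual_monoid (arcs \<Gamma>) (proj ` C)"
  using T_subset e\<^sub>0_arc
  by (auto simp: dual_monoid_def pairing_u_prime pairing_u_second cone_nonneg)
    (auto simp: u_prime_def u_second_def)

lemma u_sum: "u' + u'' = edge_vec e\<^sub>0 1"
  by (auto simp: u_prime_def u_second_def edge_vec_def flow_halves)

text \<open>Cut the potential at its value at the exceptional vertex.\<close>

lemma split_at_exceptional:
  assumes x: "x \<in> C"
  obtains x\<^sub>1 x\<^sub>2 where "x\<^sub>1 \<in> C" "x\<^sub>2 \<in> C" "x = (\<lambda>d. x\<^sub>1 d + x\<^sub>2 d)" "x\<^sub>1 es = x es" "x\<^sub>1 et = 0"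
proof -
  obtain f where f: "\<And>d. d \<in> arcs D \<Longrightarrow> f (head D d) - f (tail D d) = real (\<phi> d) * x d"
    using x by (auto simp: subdivided_cone_iff_potential[OF D.fin_digraph])
  have mono: "f (tail D d) \<le> f (head D d)" if "d \<in> arcs D" for d
  proof -
    have "real (\<phi> d) * x d \<ge> 0" using cone_nonneg[OF x] by simp
    then show ?thesis using f[OF that] by linarith
  qed
  define c where "c = f (Exceptional e\<^sub>0)"
  define f\<^sub>1 where "f\<^sub>1 v = min (f v) c" for v
  \<comment> \<open>On an edge of zero flow the potential does not determine the length. It goes to
    \<open>x\<^sub>2\<close>, except on \<open>es\<close>, whose whole length must stay in
    \<open>x\<^sub>1\<close>.\<close>
  define x\<^sub>1 where "x\<^sub>1 d = (if d \<notin> arcs D then 0 else if \<phi> d = 0 then (if d = es then x d else 0)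
    else (f\<^sub>1 (head D d) - f\<^sub>1 (tail D d)) / real (\<phi> d))" for d
  define x\<^sub>2 where "x\<^sub>2 d = x d - x\<^sub>1 d" for d
  have pot\<^sub>1: "f\<^sub>1 (head D d) - f\<^sub>1 (tail D d) = real (\<phi> d) * x\<^sub>1 d" if "d \<in> arcs D" for d
    using f[OF that] that by (auto simp: x\<^sub>1_def f\<^sub>1_def)
  have pot\<^sub>2: "(f (head D d) - f\<^sub>1 (head D d)) - (f (tail D d) - f\<^sub>1 (tail D d)) = real (\<phi> d) * x\<^sub>2 d"
    if "d \<in> arcs D" for d
    using f[OF that] pot\<^sub>1[OF that] by (simp add: x\<^sub>2_def right_diff_distrib)
  have nonneg\<^sub>1: "x\<^sub>1 d \<ge> 0" for d
    using mono[of d] cone_nonneg[OF x] by (auto simp: x\<^sub>1_def f\<^sub>1_def)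
  have nonneg\<^sub>2: "x\<^sub>2 d \<ge> 0" if d: "d \<in> arcs D" for d
  proof (cases "\<phi> d = 0")
    case True
    then show ?thesis using cone_nonneg[OF x, of d] d by (simp add: x\<^sub>2_def x\<^sub>1_def)
  next
    case False
    \<comment> \<open>The function t - min(t, c) of t is nondecreasing, so the rest of the potential
      also increases along the flow.\<close>
    have "real (\<phi> d) * x\<^sub>2 d \<ge> 0"
      unfolding pot\<^sub>2[OF d, symmetric] using mono[OF d] by (auto simp: f\<^sub>1_def min_def)
    then show ?thesis using False by (simp add: zero_le_mult_iff)
  qed
  have supp: "x\<^sub>1 d = 0" "x\<^sub>2 d = 0" if "d \<notin> arcs D" for d
    using x that by (auto simp: x\<^sub>2_def x\<^sub>1_def subdivided_cone_def)
  have "x\<^sub>1 \<in> C"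
    unfolding subdivided_cone_iff_potential[OF D.fin_digraph]
    using pot\<^sub>1 nonneg\<^sub>1 supp by (intro conjI exI[of _ f\<^sub>1]) auto
  moreover have "x\<^sub>2 \<in> C"
    unfolding subdivided_cone_iff_potential[OF D.fin_digraph]
    using pot\<^sub>2 nonneg\<^sub>2 supp by (intro conjI exI[of _ "\<lambda>v. f v - f\<^sub>1 v"]) auto
  \<comment> \<open>The edge \<open>es\<close> ends and \<open>et\<close> starts at the exceptional
    vertex, where the potential is \<open>c\<close>: on \<open>es\<close> it is at most
    \<open>c\<close>, so the cut changes nothing, and on \<open>et\<close> it is at least
    \<open>c\<close>, so the cut potential is constant.\<close>
  moreover have "x\<^sub>1 es = x es"
  proof (cases "\<phi> es = 0")
    case True
    then show ?thesis using half_arcs' by (simp add: x\<^sub>1_def)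
  next
    case False
    have "real (\<phi> es) * x\<^sub>1 es = real (\<phi> es) * x es"
      unfolding pot\<^sub>1[OF half_arcs'(1), symmetric] f[OF half_arcs'(1), symmetric]
      using mono[OF half_arcs'(1)] by (simp add: f\<^sub>1_def es c_def)
    then show ?thesis using False by simp
  qed
  moreover have "x\<^sub>1 et = 0"
    using mono[OF half_arcs'(2)] es_neq_et by (simp add: x\<^sub>1_def f\<^sub>1_def et c_def)
  ultimately show ?thesis using that[of x\<^sub>1 x\<^sub>2] by (simp add: x\<^sub>2_def)
qed

text \<open>Extremality forces the part \<open>x\<^sub>1\<close> to project to a multiple
  \<open>t\<close> of the ray. Reading off both halves gives \<open>x es = t * x es\<close> and
  \<open>0 = t * x et\<close>, so one of the two lengths is zero.\<close>

lemma extremal_ray_split: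
  assumes r: "r \<in> extremal_rays (arcs \<Gamma>) (proj ` C)"
  shows "pairing (arcs \<Gamma>) u' r = 0 \<or> pairing (arcs \<Gamma>) u'' r = 0"
proof -
  let ?r = "\<lambda>e. real_of_int (r e)"
  have r_ray: "?r \<in> ray r" by (auto simp: ray_def intro: exI[of _ 1])
  then have "?r \<in> proj ` C" using r by (auto simp: extremal_rays_def)
  then obtain x where x: "x \<in> C" "?r = proj x" by auto
  have pair: "real_of_int (pairing (arcs \<Gamma>) u' r) = x et" "real_of_int (pairing (arcs \<Gamma>) u'' r) = x es"
    using pairing_u_prime[OF x(1)] pairing_u_second[OF x(1)] by (simp_all add: pairing_of_int flip: x(2))
  obtain x\<^sub>1 x\<^sub>2 where split: "x\<^sub>1 \<in> C" "x\<^sub>2 \<in> C" "x = (\<lambda>d. x\<^sub>1 d + x\<^sub>2 d)" "x\<^sub>1 es = x es" "x\<^sub>1 et = 0"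
    using split_at_exceptional[OF x(1)] .
  have "proj x\<^sub>1 + proj x\<^sub>2 = ?r" using split(3) by (simp add: x(2) flip: proj_add)
  then have "proj x\<^sub>1 + proj x\<^sub>2 \<in> ray r" using r_ray by simp
  then have "proj x\<^sub>1 \<in> ray r" using r split(1,2) unfolding extremal_rays_def by blast
  then obtain t where t: "proj x\<^sub>1 = (\<lambda>e. t * proj x e)" by (auto simp: ray_def simp flip: x(2))
  have "x\<^sub>1 et = t * x et" "x\<^sub>1 es = t * x es"
    using arg_cong[OF t, of "pairing (arcs \<Gamma>) u'"] arg_cong[OF t, of "pairing (arcs \<Gamma>) u''"]
    by (simp_all add: pairing_scale pairing_u_prime pairing_u_second x(1) split(1))
  then have "x et = 0 \<or> x es = 0" using split(4,5) by auto
  then show ?thesis using pair by auto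
qed

end

text \<open>Reversing an edge of zero flow alters neither divergences nor slopes, and the slopes
  determine the cone. This allows the halves to be named in an orientation in which the exceptional
  vertex is the head of one and the tail of the other.\<close>

lemma flow_graph_reorient:
  assumes "flow_graph \<Gamma> \<E> D \<phi>" and D': "orientation (subdivision \<Gamma> \<E>) D'"
    and same: "\<And>e. e \<in> arcs D \<Longrightarrow> \<phi> e \<noteq> 0 \<Longrightarrow> tail D' e = tail D e \<and> head D' e = head D e"
  shows "flow_graph \<Gamma> \<E> D' \<phi>" "subdivided_cone D' \<phi> = subdivided_cone D \<phi>"
proof -
  interpret D: flow_graph \<Gamma> \<E> D \<phi> by fact
  have arcs: "arcs D' = arcs D" using D' by (simp add: orientation_def D.arcs_D)
  have sums: "(\<Sum>e | e \<in> arcs D \<and> h' e = v. int (\<phi> e)) = (\<Sum>e | e \<in> arcs D \<and> h e = v. int (\<phi> e))"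
    if "\<And>e. e \<in> arcs D \<Longrightarrow> \<phi> e \<noteq> 0 \<Longrightarrow> h' e = h e"
    for h h' :: "'b sub_edge \<Rightarrow> ('a, 'b) sub_vertex" and v
  proof -
    \<comment> \<open>As sums over all arcs with a case distinction, both sides agree termwise:
      where the ends may differ, the flow is zero.\<close>
    have "(\<Sum>e | e \<in> arcs D \<and> h' e = v. int (\<phi> e)) = (\<Sum>e\<in>arcs D. if h' e = v then int (\<phi> e) else 0)"
      "(\<Sum>e | e \<in> arcs D \<and> h e = v. int (\<phi> e)) = (\<Sum>e\<in>arcs D. if h e = v then int (\<phi> e) else 0)"
      using sum.inter_filter[OF D.D.finite_arcs, of "\<lambda>e. int (\<phi> e)"] by auto
    moreover have "(if h' e = v then int (\<phi> e) else 0) = (if h e = v then int (\<phi> e) else 0)"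
      if "e \<in> arcs D" for e
      using that \<open>\<And>e. e \<in> arcs D \<Longrightarrow> \<phi> e \<noteq> 0 \<Longrightarrow> h' e = h e\<close>[of e] by (cases "\<phi> e = 0") auto
    ultimately show ?thesis by (simp cong: sum.cong)
  qed
  have "flow_div D' \<phi> v = flow_div D \<phi> v" for v
    unfolding flow_div_def arcs using same sums[of "head D'" "head D"] sums[of "tail D'" "tail D"] by simp
  then show D'_graph: "flow_graph \<Gamma> \<E> D' \<phi>"
    using D.fin D.nondisc D' D.div by unfold_locales simp_all
  interpret D': flow_graph \<Gamma> \<E> D' \<phi> by (rule D'_graph)
  have "D'.slope d = D.slope d" if "d \<in> arcs D" for d
    using same[OF that] by (cases "\<phi> d = 0") (auto simp: D'.slope_def D.slope_def)
  then show "subdivided_cone D' \<phi> = subdivided_cone D \<phi>"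
    by (auto simp: D'.cone_iff_slope D.cone_iff_slope arcs)
qed

theorem proposition5p7:
  fixes \<Gamma> :: "('v, 'e) pre_digraph"
    and \<E> :: "'e set"
    and D :: "(('v, 'e) sub_vertex, 'e sub_edge) pre_digraph"
    and \<phi> :: "'e sub_edge \<Rightarrow> nat"
    and e\<^sub>0 :: 'e
    and K :: "('e \<Rightarrow> real) set"
    and A :: "('e, 'k::alg_closed_field) poly_xy set ring"
    and y :: "('e, 'k) poly_xy set"
  assumes "fin_digraph \<Gamma>"
    and "nondisconnecting \<Gamma> \<E>"
    and "orientation (subdivision \<Gamma> \<E>) D"
    and "acyclic_flow D \<phi>"
    and "\<forall>e\<in>\<E>. flow_div D \<phi> (Exceptional e) = -1"
    and "e\<^sub>0 \<in> arcs \<Gamma>"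
    and "K = flow_cone \<Gamma> \<E> D \<phi>"
    and "A = A_tau (arcs \<Gamma>) K e\<^sub>0"
    and "y = tau_y (arcs \<Gamma>) K e\<^sub>0"
  shows
    "(e\<^sub>0 \<in> \<E> \<longrightarrow>
       (\<forall>T D' es et \<gamma> u' u''.
          spanning_tree_edges \<Gamma> T \<and> T \<inter> \<E> = {} \<and>
          orientation (subdivision \<Gamma> \<E>) D' \<and>
          (\<forall>e\<in>arcs D. \<phi> e \<noteq> 0 \<longrightarrow> tail D' e = tail D e \<and> head D' e = head D e) \<and>
          {es, et} = edges_over \<E> e\<^sub>0 \<and>
          head D' es = Exceptional e\<^sub>0 \<and> tail D' et = Exceptional e\<^sub>0 \<and>
          undirected_cycle D' \<gamma> \<and> fst ` set \<gamma> \<subseteq> {es, et} \<union> Whole ` T \<and>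
          cycle_sign \<gamma> es = 1 \<and> cycle_sign \<gamma> et = 1 \<and>
          u' = u_prime \<phi> T \<gamma> e\<^sub>0 es \<and> u'' = u_second \<phi> T \<gamma> e\<^sub>0 et
        \<longrightarrow>
          carrier A
          \<inter> (\<Inter>r\<in>{r \<in> extremal_rays (arcs \<Gamma>) K. pairing (arcs \<Gamma>) u' r = 0}.
               ray_ideal (arcs \<Gamma>) K e\<^sub>0 r (\<phi> et))
          \<inter> (\<Inter>r\<in>{r \<in> extremal_rays (arcs \<Gamma>) K. pairing (arcs \<Gamma>) u'' r = 0}.
               ray_ideal (arcs \<Gamma>) K e\<^sub>0 r (\<phi> es))
          = ideal_prod A (ideal_power A (Idl\<^bsub>A\<^esub> {y}) (\<phi> es))
              (Idl\<^bsub>A\<^esub> {y, tau_char (arcs \<Gamma>) K e\<^sub>0 u''}))) \<and>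
     (e\<^sub>0 \<notin> \<E> \<longrightarrow>
        carrier A
        \<inter> (\<Inter>r\<in>extremal_rays (arcs \<Gamma>) K. ray_ideal (arcs \<Gamma>) K e\<^sub>0 r (\<phi> (Whole e\<^sub>0)))
        = ideal_power A (Idl\<^bsub>A\<^esub> {y}) (\<phi> (Whole e\<^sub>0)))"
  proof -
  interpret flow_graph \<Gamma> \<E> D \<phi>
    using assms by (simp add: flow_graph_def)
  interpret K: ray_generated_cone "arcs \<Gamma>" K e\<^sub>0
    unfolding assms(7) by (rule ray_generated) fact
  show ?thesis
    unfolding assms(8,9)
  proof (intro conjI impI allI)
    show "carrier (A_tau (arcs \<Gamma>) K e\<^sub>0 :: ('e, 'k) poly_xy set ring)
        \<inter> (\<Inter>r\<in>extremal_rays (arcs \<Gamma>) K. ray_ideal (arcs \<Gamma>) K e\<^sub>0 r (\<phi> (Whole e\<^sub>0)))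
      = ideal_power (A_tau (arcs \<Gamma>) K e\<^sub>0)
          (Idl\<^bsub>A_tau (arcs \<Gamma>) K e\<^sub>0\<^esub> {tau_y (arcs \<Gamma>) K e\<^sub>0}) (\<phi> (Whole e\<^sub>0))"
      by (rule K.Inter_ray_ideals)
  next
    fix T D' es et \<gamma> u' u''
    assume e\<^sub>0: "e\<^sub>0 \<in> \<E>"
    assume hyps: "spanning_tree_edges \<Gamma> T \<and> T \<inter> \<E> = {} \<and>
          orientation (subdivision \<Gamma> \<E>) D' \<and>
          (\<forall>e\<in>arcs D. \<phi> e \<noteq> 0 \<longrightarrow> tail D' e = tail D e \<and> head D' e = head D e) \<and>
          {es, et} = edges_over \<E> e\<^sub>0 \<and>
          head D' es = Exceptional e\<^sub>0 \<and> tail D' et = Exceptional e\<^sub>0 \<and>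
          undirected_cycle D' \<gamma> \<and> fst ` set \<gamma> \<subseteq> {es, et} \<union> Whole ` T \<and>
          cycle_sign \<gamma> es = 1 \<and> cycle_sign \<gamma> et = 1 \<and>
          u' = u_prime \<phi> T \<gamma> e\<^sub>0 es \<and> u'' = u_second \<phi> T \<gamma> e\<^sub>0 et"
    \<comment> \<open>The halves and \<gamma> refer to \<open>D'\<close>. Since both orientations
      have the same cone, \<open>K\<close> can be computed from \<open>D'\<close>.\<close>
    have D': "flow_graph \<Gamma> \<E> D' \<phi>" "subdivided_cone D' \<phi> = C"
      using hyps by (auto intro!: flow_graph_reorient[OF flow_graph_axioms])
    interpret S: subdivided_edge \<Gamma> \<E> D' \<phi> T es et \<gamma> e\<^sub>0
      by (intro subdivided_edge.intro subdivided_edge_axioms.intro D'(1) e\<^sub>0) (use hyps in blast)+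
    have K: "K = S.proj ` S.C"
      by (simp add: assms(7) flow_cone_def D'(2) S.proj_def[abs_def])
    show "carrier (A_tau (arcs \<Gamma>) K e\<^sub>0 :: ('e, 'k) poly_xy set ring)
        \<inter> (\<Inter>r\<in>{r \<in> extremal_rays (arcs \<Gamma>) K. pairing (arcs \<Gamma>) u' r = 0}.
             ray_ideal (arcs \<Gamma>) K e\<^sub>0 r (\<phi> et))
        \<inter> (\<Inter>r\<in>{r \<in> extremal_rays (arcs \<Gamma>) K. pairing (arcs \<Gamma>) u'' r = 0}.
             ray_ideal (arcs \<Gamma>) K e\<^sub>0 r (\<phi> es))
      = ideal_prod (A_tau (arcs \<Gamma>) K e\<^sub>0)
          (ideal_power (A_tau (arcs \<Gamma>) K e\<^sub>0)
            (Idl\<^bsub>A_tau (arcs \<Gamma>) K e\<^sub>0\<^esub> {tau_y (arcs \<Gamma>) K e\<^sub>0}) (\<phi> es))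
          (Idl\<^bsub>A_tau (arcs \<Gamma>) K e\<^sub>0\<^esub> {tau_y (arcs \<Gamma>) K e\<^sub>0, tau_char (arcs \<Gamma>) K e\<^sub>0 u''})"
      unfolding S.flow_halves
      using hyps S.u_dual S.u_sum S.extremal_ray_split
      by (intro K.Inter_ray_ideals_split) (simp_all add: K)
  qed
qed

end
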